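(* Let $X=(X_1,\dots,X_p)^T$ and $Y=(Y_1,\dots,Y_p)^T$ be centered Gaussian random vectors in $\mathbb{R}^p$ with covariance matrices $\Sigma^X=(\sigma^X_{jk})_{1\le j,k\le p}$ and $\Sigma^Y=(\sigma^Y_{jk})_{1\le j,k\le p}$, respectively, and let $\Delta:=\max_{1\le j,k\le p}|\sigma^X_{jk}-\sigma^Y_{jk}|$. For $\beta>0$ and $z=(z_1,\dots,z_p)^T\in\mathbb{R}^p$ let $F_\beta(z):=\beta^{-1}\log\left(\sum_{j=1}^p\exp(\beta z_j)\right)$. Then for every $g\in C^2(\mathbb{R})$ with $\max\{\|g'\|_\infty,\|g''\|_\infty\}<\infty$ and every $\beta>0$, $$\left|\mathrm{E}[g(F_\beta(X))-g(F_\beta(Y))]\right|\le\left(\|g''\|_\infty/2+\beta\|g'\|_\infty\right)\Delta,$$ and hence $$\left|\mathrm{E}\left[g\left(\max_{1\le j\le p}X_j\right)-g\left(\max_{1\le j\le p}Y_j\right)\right]\right|\le\left(\|g''\|_\infty/2+\beta\|g'\|_\infty\right)\Delta+2\beta^{-1}\|g'\|_\infty\log p.$$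
   Context: For a function $h:\mathbb{R}\to\mathbb{R}$, $\|h\|_\infty:=\sup_{z\in\mathbb{R}}|h(z)|$. No restriction is placed on the covariance matrices (they may be singular). *)

theory Defs
  imports "HOL-Probability.Probability"
begin

(* The second disjunct is the normal law with variance zero. *)
definition gaussian_rv :: "'w measure \<Rightarrow> ('w \<Rightarrow> real) \<Rightarrow> bool" where
  "gaussian_rv M Z \<longleftrightarrow>
     (\<exists>\<mu> \<sigma>. 0 < \<sigma> \<and> distributed M lborel Z (normal_density \<mu> \<sigma>)) \<or>
     (\<exists>\<mu>. Z \<in> borel_measurable M \<and> (AE w in M. Z w = \<mu>))"

(* Since degenerate normal laws are admitted in every direction a, the covariance matrix
   may be singular. *)
definition gaussian_vector :: "'w measure \<Rightarrow> ('w \<Rightarrow> real ^ 'n) \<Rightarrow> bool" where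
  "gaussian_vector M X \<longleftrightarrow>
     X \<in> borel_measurable M \<and> (\<forall>a. gaussian_rv M (\<lambda>w. a \<bullet> X w))"

definition centered :: "'w measure \<Rightarrow> ('w \<Rightarrow> real ^ 'n) \<Rightarrow> bool" where
  "centered M X \<longleftrightarrow> (\<forall>j. (\<integral>w. X w $ j \<partial>M) = 0)"

definition covariance :: "'w measure \<Rightarrow> ('w \<Rightarrow> real) \<Rightarrow> ('w \<Rightarrow> real) \<Rightarrow> real" where
  "covariance M U V = (\<integral>w. (U w - (\<integral>v. U v \<partial>M)) * (V w - (\<integral>v. V v \<partial>M)) \<partial>M)"

definition covariance_matrix :: "'w measure \<Rightarrow> ('w \<Rightarrow> real ^ 'n) \<Rightarrow> real ^ 'n ^ 'n" where
  "covariance_matrix M X = (\<chi> j k. covariance M (\<lambda>w. X w $ j) (\<lambda>w. X w $ k))"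

definition max_entry_diff :: "real ^ 'n ^ 'n \<Rightarrow> real ^ 'n ^ 'n \<Rightarrow> real" where
  "max_entry_diff A B = Max {\<bar>A $ j $ k - B $ j $ k\<bar> |j k. True}"

definition smooth_max :: "real \<Rightarrow> real ^ 'n \<Rightarrow> real" where
  "smooth_max \<beta> z = inverse \<beta> * ln (\<Sum>j\<in>UNIV. exp (\<beta> * z $ j))"

definition max_component :: "real ^ 'n \<Rightarrow> real" where
  "max_component z = Max (range (\<lambda>j. z $ j))"

definition C2 :: "(real \<Rightarrow> real) \<Rightarrow> bool" where
  "C2 g \<longleftrightarrow>
     (\<forall>x. g differentiable at x) \<and>
     (\<forall>x. deriv g differentiable at x) \<and>
     continuous_on UNIV (deriv (deriv g))"

(* A real-valued supremum: meaningful only when h is bounded. Finiteness of the norm is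
   expressed separately by bounded (range h). *)
definition sup_norm :: "(real \<Rightarrow> real) \<Rightarrow> real" where
  "sup_norm h = (SUP z. \<bar>h z\<bar>)"

end

theory Submission
  imports Defs "HOL-Real_Asymp.Real_Asymp"
begin

text \<open>
  The expectation of a function of a Gaussian vector is changed from the law of \<open>X\<close> to that of \<open>Y\<close> in
  many small steps. Let \<open>P\<^sub>s f x = E f (x + sqrt s X)\<close> and let \<open>Q\<^sub>s\<close> be the same operator for \<open>Y\<close>; in the formal
  text these are \<open>smear M X s\<close> and \<open>smear M Y s\<close>. Each family is a semigroup of contractions in the
  uniform norm, and the two families commute. Hence \<open>P\<^sub>1 f - Q\<^sub>1 f\<close> is at most \<open>n\<close> times the uniform
  norm of \<open>P\<^sub>h f - Q\<^sub>h f\<close> with \<open>h = 1/n\<close> (\<open>smear_telescope\<close>). A second-order Taylor expansion shows that this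
  norm is at most \<open>h B \<Delta> / 2 + O(h sqrt h)\<close>, where \<open>B\<close> bounds the sum of the absolute entries of the
  Hessian of \<open>f\<close>; so \<open>n \<rightarrow> \<infinity>\<close> gives the bound \<open>B \<Delta> / 2\<close> (\<open>gaussian_comparison\<close>).

  The semigroup property (\<open>smear_smear\<close>) says that \<open>sqrt s X + sqrt t X'\<close> has the law of \<open>sqrt (s + t) X\<close> when
  \<open>X'\<close> is an independent copy of \<open>X\<close>. Gaussian vectors are given through their one-dimensional projections,
  and these do agree by the formula for the characteristic function of a normal law. Passing from the
  projections to the vectors is the theorem of Cramer and Wold, proved for Lipschitz functions by
  approximation with trigonometric polynomials (\<open>integral_eq_if_cos_integrals_eq\<close>). The argument refers
  to the projections only, so that it covers singular covariance matrices.

  For \<open>f = g \<circ> smooth_max \<beta>\<close> the Hessian is expressed by the Gibbs weights, which are nonnegative and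
  sum to one; this gives \<open>B = \<parallel>g''\<parallel> + 2 \<beta> \<parallel>g'\<parallel>\<close> in any dimension (\<open>smooth_max_hessian_abs_sum_le\<close>).
  The Taylor remainder is uniform when \<open>g\<close> has a bounded third derivative, and moving averages of \<open>g\<close>
  reduce the general case to this one (\<open>C3_approximation\<close>). The second inequality follows from the
  first, because \<open>smooth_max \<beta>\<close> and the maximum differ by at most \<open>ln p / \<beta>\<close> in dimension \<open>p\<close>
  (\<open>max_component_smooth_max\<close>) and \<open>g\<close> is Lipschitz.
\<close>

section \<open>Projections determine expectations of Lipschitz functions\<close>

text \<open>
  Trigonometric polynomials are built from cosines with arbitrary real frequencies and phases: the
  phase covers the sines, and no common period is imposed, so that every one-dimensional projection
  of a random vector is tested.
\<close>

inductive trig_poly :: "('a::euclidean_space \<Rightarrow> real) \<Rightarrow> bool" where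
  cosine: "trig_poly (\<lambda>x. cos (a \<bullet> x + b))"
| scale: "trig_poly f \<Longrightarrow> trig_poly (\<lambda>x. c * f x)"
| add: "trig_poly f \<Longrightarrow> trig_poly g \<Longrightarrow> trig_poly (\<lambda>x. f x + g x)"

lemma trig_poly_const: "trig_poly (\<lambda>x. c)"
  using trig_poly.scale[OF trig_poly.cosine[of 0 0], of c] by simp

lemma trig_poly_sum:
  "(\<And>i. i \<in> I \<Longrightarrow> trig_poly (f i)) \<Longrightarrow> trig_poly (\<lambda>x. \<Sum>i\<in>I. f i x)"
  by (induction I rule: infinite_finite_induct) (auto intro: trig_poly_const trig_poly.add)

lemma trig_poly_cos_mult:
  assumes "trig_poly g"
  shows "trig_poly (\<lambda>x. cos (a \<bullet> x + b) * g x)"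
  using assms
proof induction
  case (cosine a' b')
  have eq: "(\<lambda>x. cos (a \<bullet> x + b) * cos (a' \<bullet> x + b')) =
     (\<lambda>x. (1/2) * cos ((a - a') \<bullet> x + (b - b')) + (1/2) * cos ((a + a') \<bullet> x + (b + b')))"
  proof
    fix x
    have 1: "(a - a') \<bullet> x + (b - b') = (a \<bullet> x + b) - (a' \<bullet> x + b')"
      "(a + a') \<bullet> x + (b + b') = (a \<bullet> x + b) + (a' \<bullet> x + b')"
      by (simp_all add: inner_diff_left inner_add_left)
    show "cos (a \<bullet> x + b) * cos (a' \<bullet> x + b') =
      (1/2) * cos ((a - a') \<bullet> x + (b - b')) + (1/2) * cos ((a + a') \<bullet> x + (b + b'))"
      unfolding 1 cos_times_cos by (simp add: add_divide_distrib)
  qed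
  show ?case unfolding eq by (intro trig_poly.intros)
next
  case (scale f c)
  from trig_poly.scale[OF scale.IH, of c] show ?case by (simp add: mult.left_commute)
next
  case (add f g)
  from trig_poly.add[OF add.IH] show ?case by (simp add: distrib_left)
qed

lemma trig_poly_mult:
  assumes "trig_poly f" and g: "trig_poly g"
  shows "trig_poly (\<lambda>x. f x * g x)"
  using assms(1)
proof induction
  case (cosine a b)
  show ?case by (rule trig_poly_cos_mult[OF g])
next
  case (scale f c)
  from trig_poly.scale[OF scale.IH, of c] show ?case by (simp add: mult.assoc)
next
  case (add f f')
  from trig_poly.add[OF add.IH] show ?case by (simp add: distrib_right)
qed

text \<open>
  The multiple \<open>L *\<^sub>R sin_coords L\<close> has bounded range and tends pointwise to the identity as \<open>L\<close> grows.
  A polynomial in the coordinates of \<open>sin_coords L x\<close> is a trigonometric polynomial in \<open>x\<close>, and these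
  coordinates stay in one cube; hence Stone--Weierstrass on that cube controls the error
  on the whole space, tails included.
\<close>

definition sin_coords :: "real \<Rightarrow> 'a::euclidean_space \<Rightarrow> 'a" where
  "sin_coords L x = (\<Sum>i\<in>Basis. sin ((x \<bullet> i) / L) *\<^sub>R i)"

lemma cos_shift_eq_sin:
  fixes i x :: "'a::euclidean_space"
  shows "cos ((i /\<^sub>R L) \<bullet> x + - (pi / 2)) = sin ((x \<bullet> i) / L)" 
proof -
  have "(i /\<^sub>R L) \<bullet> x + - (pi / 2) = - (pi / 2 - (x \<bullet> i) / L)"
    unfolding inner_scaleR_left inner_commute[of i x] divide_inverse by (simp only: mult.commute minus_diff_eq diff_conv_add_uminus)
  then show ?thesis by (simp only: cos_minus sin_cos_eq of_real_eq_id id_apply)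
qed

lemma linear_sin_coords:
  assumes "bounded_linear h" shows "h (sin_coords L x) = (\<Sum>i\<in>Basis. h i * sin ((x \<bullet> i) / L))"
  using bounded_linear.linear[OF assms]
  unfolding sin_coords_def 
  by (simp add: linear_sum linear_scale mult.commute)

lemma trig_poly_polynomial_sin:
  fixes P :: "'a::euclidean_space \<Rightarrow> real"
  assumes "real_polynomial_function P"
  shows "trig_poly (\<lambda>x. P (sin_coords L x))"
  using assms
proof induction
  case (linear h)
  show ?case unfolding linear_sin_coords[OF linear] cos_shift_eq_sin[symmetric] by (intro trig_poly_sum trig_poly.scale trig_poly.cosine)
next case (const c) show ?case by (rule trig_poly_const)
next case (add f g) then show ?case by (intro trig_poly.add)
next case (mult f g) then show ?case by (intro trig_poly_mult)
qed 

lemma trig_poly_continuous_bounded: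
  assumes "trig_poly f"
  shows "continuous_on UNIV f \<and> (\<exists>B. \<forall>x. \<bar>f x\<bar> \<le> B)"
  using assms
proof induction
  case (cosine a b)
  show ?case by (auto intro!: continuous_intros exI[of _ 1])
next
  case (scale f c)
  then obtain B where "\<And>x. \<bar>f x\<bar> \<le> B" by auto
  then have "\<bar>c * f x\<bar> \<le> \<bar>c\<bar> * B" for x by (simp add: abs_mult mult_left_mono)
  with scale show ?case by (auto intro!: continuous_intros)
next
  case (add f g)
  then obtain B B' where "\<And>x. \<bar>f x\<bar> \<le> B" "\<And>x. \<bar>g x\<bar> \<le> B'" by blast
  then have "\<bar>f x + g x\<bar> \<le> B + B'" for x by (meson abs_triangle_ineq add_mono order_trans)
  with add show ?case by (auto intro!: continuous_intros)
qed

lemma integrable_continuous_bounded: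
  fixes f :: "'a::euclidean_space \<Rightarrow> real"
  assumes "prob_space M" and U: "U \<in> borel_measurable M"
    and f: "continuous_on UNIV f" and B: "\<And>x. \<bar>f x\<bar> \<le> B"
  shows "integrable M (\<lambda>w. f (U w))"
proof -
  interpret prob_space M by fact
  have [measurable]: "f \<in> borel_measurable borel"
    using f by (rule borel_measurable_continuous_onI)
  note [measurable] = U
  show ?thesis
    by (rule integrable_const_bound[of _ B]) (use B in auto)
qed

lemma trig_poly_integrable:
  assumes "prob_space M" "U \<in> borel_measurable M" "trig_poly f"
  shows "integrable M (\<lambda>w. f (U w))"
  using trig_poly_continuous_bounded[OF assms(3)] integrable_continuous_bounded[OF assms(1,2)] by metis

lemma trig_poly_integral_eq:
  assumes M: "prob_space M" and U: "U \<in> borel_measurable M"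
    and N: "prob_space N" and V: "V \<in> borel_measurable N"
    and eq: "\<And>a b. (\<integral>w. cos (a \<bullet> U w + b) \<partial>M) = (\<integral>w. cos (a \<bullet> V w + b) \<partial>N)"
    and f: "trig_poly f"
  shows "(\<integral>w. f (U w) \<partial>M) = (\<integral>w. f (V w) \<partial>N)"
  using f
proof induction
  case (cosine a b)
  show ?case by (rule eq)
next
  case (scale f c)
  then show ?case by simp
next
  case (add f g)
  then show ?case
    using trig_poly_integrable[OF M U] trig_poly_integrable[OF N V] by simp
qed

lemma lipschitz_on_growth:
  fixes f :: "'a::real_normed_vector \<Rightarrow> real"
  assumes "C-lipschitz_on UNIV f"
  shows "\<bar>f x - f y\<bar> \<le> C * norm (x - y)" "\<bar>f x\<bar> \<le> \<bar>f 0\<bar> + C * norm x"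
proof -
  show "\<bar>f x - f y\<bar> \<le> C * norm (x - y)" for x y
    using lipschitz_onD[OF assms, of x y] by (simp add: dist_norm)
  from this[of x 0] show "\<bar>f x\<bar> \<le> \<bar>f 0\<bar> + C * norm x" by simp
qed

lemma integrable_lipschitz:
  fixes f :: "'a::euclidean_space \<Rightarrow> real"
  assumes "prob_space M" and U: "integrable M U" and f: "C-lipschitz_on UNIV f"
  shows "integrable M (\<lambda>w. f (U w))"
proof -
  interpret prob_space M by fact
  have [measurable]: "f \<in> borel_measurable borel"
    using lipschitz_on_continuous_on[OF f] by (rule borel_measurable_continuous_onI)
  note [measurable] = borel_measurable_integrable[OF U]
  show ?thesis
  proof (rule Bochner_Integration.integrable_bound)
    show "integrable M (\<lambda>w. \<bar>f 0\<bar> + C * norm (U w))" using U by simp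
    show "AE w in M. norm (f (U w)) \<le> norm (\<bar>f 0\<bar> + C * norm (U w))"
      using lipschitz_on_growth(2)[OF f] lipschitz_on_nonneg[OF f] by (simp add: order_trans[OF _ abs_ge_self])
  qed simp
qed

lemma integral_sin_coords_eq:
  fixes U :: "'w \<Rightarrow> 'a::euclidean_space" and V :: "'v \<Rightarrow> 'a"
  assumes M: "prob_space M" and U: "U \<in> borel_measurable M"
    and N: "prob_space N" and V: "V \<in> borel_measurable N"
    and eq: "\<And>a b. (\<integral>w. cos (a \<bullet> U w + b) \<partial>M) = (\<integral>w. cos (a \<bullet> V w + b) \<partial>N)"
    and f: "continuous_on UNIV (f :: 'a \<Rightarrow> real)"
  shows "(\<integral>w. f (sin_coords L (U w)) \<partial>M) = (\<integral>w. f (sin_coords L (V w)) \<partial>N)"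
proof -
  have cont: "continuous_on UNIV (sin_coords L :: 'a \<Rightarrow> 'a)"
    unfolding sin_coords_def[abs_def] divide_inverse by (intro continuous_intros)
  have range: "sin_coords L x \<in> cbox (- One) One" for x :: 'a
    by (auto simp: mem_box sin_coords_def)
  have contf: "continuous_on UNIV (\<lambda>x. f (sin_coords L x))"
    using continuous_on_compose[OF cont continuous_on_subset[OF f subset_UNIV]] by (simp add: o_def)
  have "bounded (f ` cbox (- One) One)"
    by (intro compact_imp_bounded compact_continuous_image continuous_on_subset[OF f]) auto
  then obtain B where B: "\<And>x. \<bar>f (sin_coords L x)\<bar> \<le> B"
    using range unfolding bounded_iff by force
  note int = integrable_continuous_bounded[OF _ _ contf B]
  have key: "\<bar>(\<integral>w. f (sin_coords L (U w)) \<partial>M) - (\<integral>w. f (sin_coords L (V w)) \<partial>N)\<bar> \<le> 2 * e" if e: "e > 0" for e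
  proof -
    obtain P where P: "real_polynomial_function P" "\<And>x. x \<in> cbox (- One) One \<Longrightarrow> \<bar>f x - P x\<bar> < e"
      using Stone_Weierstrass_real_polynomial_function[OF compact_cbox _ e, of "- One" One f]
        continuous_on_subset[OF f subset_UNIV] by blast
    let ?P = "\<lambda>x. P (sin_coords L x)"
    have T: "trig_poly ?P" by (rule trig_poly_polynomial_sin[OF P(1)])
    have close: "\<bar>(\<integral>w. f (sin_coords L (W w)) \<partial>Q) - (\<integral>w. ?P (W w) \<partial>Q)\<bar> \<le> e"
      if Q: "prob_space Q" and W: "W \<in> borel_measurable Q" for Q :: "'z measure" and W
    proof -
      interpret prob_space Q by fact
      have i: "integrable Q (\<lambda>w. f (sin_coords L (W w)))" "integrable Q (\<lambda>w. ?P (W w))"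
        by (rule int[OF Q W], rule trig_poly_integrable[OF Q W T])
      have "\<bar>(\<integral>w. f (sin_coords L (W w)) \<partial>Q) - (\<integral>w. ?P (W w) \<partial>Q)\<bar>
          = \<bar>\<integral>w. f (sin_coords L (W w)) - ?P (W w) \<partial>Q\<bar>"
        by (simp add: Bochner_Integration.integral_diff[OF i])
      also have "\<dots> \<le> (\<integral>w. \<bar>f (sin_coords L (W w)) - ?P (W w)\<bar> \<partial>Q)"
        by (rule integral_abs_bound)
      also have "\<dots> \<le> (\<integral>w. e \<partial>Q)"
        using P(2)[OF range] i by (intro integral_mono) (auto intro!: less_imp_le)
      finally show ?thesis by (simp add: prob_space)
    qed
    show ?thesis
      using close[OF M U] close[OF N V] trig_poly_integral_eq[OF M U N V eq T] by linarith
  qed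
  have "\<bar>(\<integral>w. f (sin_coords L (U w)) \<partial>M) - (\<integral>w. f (sin_coords L (V w)) \<partial>N)\<bar> \<le> 0"
    by (rule field_le_epsilon) (use key[of "e/2" for e] in force)
  then show ?thesis by simp
qed

text \<open>
  This bound makes \<open>f (L sin (x / L))\<close> dominated by the linear growth of a Lipschitz function \<open>f\<close>,
  uniformly in \<open>L\<close>.
\<close>

lemma scaled_sin_coords_norm_le:
  assumes "L > 0"
  shows "norm (L *\<^sub>R sin_coords L x) \<le> norm x"
proof (rule norm_le_componentwise)
  fix b :: 'a assume b: "b \<in> Basis"
  have "\<bar>sin ((x \<bullet> b) / L)\<bar> \<le> \<bar>(x \<bullet> b) / L\<bar>" by (rule abs_sin_x_le_abs_x)
  then have "L * \<bar>sin ((x \<bullet> b) / L)\<bar> \<le> \<bar>x \<bullet> b\<bar>"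
    using assms by (simp add: field_simps)
  then show "\<bar>(L *\<^sub>R sin_coords L x) \<bullet> b\<bar> \<le> \<bar>x \<bullet> b\<bar>"
    using assms b by (simp add: sin_coords_def abs_mult)
qed

lemma scaled_sin_coords_tendsto:
  "(\<lambda>n. real (Suc n) *\<^sub>R sin_coords (real (Suc n)) x) \<longlonglongrightarrow> x"
proof -
  have one: "(\<lambda>n. real (Suc n) * sin (t / real (Suc n))) \<longlonglongrightarrow> t" for t
    by real_asymp
  have "(\<lambda>n. \<Sum>i\<in>Basis. (real (Suc n) * sin ((x \<bullet> i) / real (Suc n))) *\<^sub>R i) \<longlonglongrightarrow> (\<Sum>i\<in>Basis. (x \<bullet> i) *\<^sub>R i)"
    by (intro tendsto_intros one)
  then show ?thesis
    by (simp add: sin_coords_def scaleR_sum_right euclidean_representation)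
qed

text \<open>
  A form of the theorem of Cramer and Wold: the one-dimensional projections of an integrable random
  vector determine the expectations of Lipschitz functions. The cosine integrals fix the
  expectations of all \<open>f (L sin (x / L))\<close>, and dominated convergence removes the truncation.
\<close>

lemma integral_eq_if_cos_integrals_eq:
  fixes U :: "'w \<Rightarrow> 'a::euclidean_space" and V :: "'v \<Rightarrow> 'a" and f :: "'a \<Rightarrow> real"
  assumes M: "prob_space M" and U: "integrable M U"
    and N: "prob_space N" and V: "integrable N V"
    and eq: "\<And>a b. (\<integral>w. cos (a \<bullet> U w + b) \<partial>M) = (\<integral>w. cos (a \<bullet> V w + b) \<partial>N)"
    and f: "C-lipschitz_on UNIV f"
  shows "(\<integral>w. f (U w) \<partial>M) = (\<integral>w. f (V w) \<partial>N)"
proof -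
  define S where "S n x = real (Suc n) *\<^sub>R sin_coords (real (Suc n)) x" for n and x :: 'a
  have cf: "continuous_on UNIV f" by (rule lipschitz_on_continuous_on[OF f])
  have [measurable]: "f \<in> borel_measurable borel" by (rule borel_measurable_continuous_onI[OF cf])
  have "continuous_on UNIV (S n)" for n
    unfolding S_def[abs_def] sin_coords_def[abs_def] divide_inverse by (intro continuous_intros)
  then have [measurable]: "S n \<in> borel_measurable borel" for n
    by (rule borel_measurable_continuous_onI)
  have lim: "(\<lambda>n. \<integral>w. f (S n (W w)) \<partial>Q) \<longlonglongrightarrow> (\<integral>w. f (W w) \<partial>Q)"
    if "integrable Q W" "prob_space Q" for Q :: "'z measure" and W
  proof -
    interpret prob_space Q by fact
    note [measurable] = borel_measurable_integrable[OF that(1)]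
    show ?thesis
    proof (rule integral_dominated_convergence[where w = "\<lambda>w. \<bar>f 0\<bar> + C * norm (W w)"])
      show "integrable Q (\<lambda>w. \<bar>f 0\<bar> + C * norm (W w))" using that by simp
      show "AE x in Q. (\<lambda>n. f (S n (W x))) \<longlonglongrightarrow> f (W x)"
        unfolding S_def
        by (intro AE_I2 continuous_on_tendsto_compose[OF cf scaled_sin_coords_tendsto]) auto
      show "AE x in Q. norm (f (S n (W x))) \<le> \<bar>f 0\<bar> + C * norm (W x)" for n
      proof (rule AE_I2)
        fix x
        have "norm (S n (W x)) \<le> norm (W x)"
          unfolding S_def by (rule scaled_sin_coords_norm_le) simp
        then show "norm (f (S n (W x))) \<le> \<bar>f 0\<bar> + C * norm (W x)"
          using lipschitz_on_growth(2)[OF f, of "S n (W x)"]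
            mult_left_mono[OF _ lipschitz_on_nonneg[OF f], of "norm (S n (W x))" "norm (W x)"]
          by simp
      qed
    qed measurable
  qed
  have "(\<integral>w. f (S n (U w)) \<partial>M) = (\<integral>w. f (S n (V w)) \<partial>N)" for n
  proof -
    have "continuous_on UNIV (\<lambda>x. f (real (Suc n) *\<^sub>R x))"
      by (intro continuous_on_compose2[OF cf] continuous_intros) auto
    from integral_sin_coords_eq[OF M borel_measurable_integrable[OF U] N borel_measurable_integrable[OF V] eq this]
    show ?thesis by (simp add: S_def)
  qed
  then show ?thesis
    using LIMSEQ_unique[OF lim[OF U M]] lim[OF V N] by simp
qed

section \<open>Moments and cosine integrals of Gaussian vectors\<close>

text \<open>
  The bound \<open>\<bar>a + b\<bar> ^ k \<le> 2 ^ k * (\<bar>a\<bar> ^ k + \<bar>b\<bar> ^ k)\<close> reduces absolute moments to central ones.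
\<close>

lemma gaussian_rv_integrable_power:
  assumes "prob_space M" and Z: "gaussian_rv M Z"
  shows "integrable M (\<lambda>w. \<bar>Z w\<bar> ^ k)"
proof -
  interpret prob_space M by fact
  from Z consider \<mu> \<sigma> where "0 < \<sigma>" "distributed M lborel Z (normal_density \<mu> \<sigma>)"
    | \<mu> where "Z \<in> borel_measurable M" "AE w in M. Z w = \<mu>"
    unfolding gaussian_rv_def by blast
  then show ?thesis
  proof cases
    case 1
    have Zm: "Z \<in> borel_measurable M" using distributed_measurable[OF 1(2)] by simp
    have "integrable M (\<lambda>w. \<bar>Z w - \<mu>\<bar> ^ k)"
      using distributed_integrable[OF 1(2), of "\<lambda>x. \<bar>x - \<mu>\<bar> ^ k"] integrable_normal_moment_abs[OF 1(1)]
      by simp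
    then have int: "integrable M (\<lambda>w. 2 ^ k * (\<bar>Z w - \<mu>\<bar> ^ k + \<bar>\<mu>\<bar> ^ k))" by simp
    show ?thesis
    proof (rule Bochner_Integration.integrable_bound[OF int])
      show "(\<lambda>w. \<bar>Z w\<bar> ^ k) \<in> borel_measurable M" using Zm by measurable
      have "\<bar>z\<bar> ^ k \<le> 2 ^ k * (\<bar>z - \<mu>\<bar> ^ k + \<bar>\<mu>\<bar> ^ k)" for z
      proof -
        have "\<bar>z\<bar> \<le> 2 * max \<bar>z - \<mu>\<bar> \<bar>\<mu>\<bar>" by (auto simp: max_def abs_if)
        then have "\<bar>z\<bar> ^ k \<le> (2 * max \<bar>z - \<mu>\<bar> \<bar>\<mu>\<bar>) ^ k" by (rule power_mono) simp
        also have "\<dots> = 2 ^ k * max \<bar>z - \<mu>\<bar> \<bar>\<mu>\<bar> ^ k" by (rule power_mult_distrib)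
        also have "max \<bar>z - \<mu>\<bar> \<bar>\<mu>\<bar> ^ k \<le> \<bar>z - \<mu>\<bar> ^ k + \<bar>\<mu>\<bar> ^ k" by (simp add: max_def)
        finally show ?thesis by simp
      qed
      then show "AE w in M. norm (\<bar>Z w\<bar> ^ k) \<le> norm (2 ^ k * (\<bar>Z w - \<mu>\<bar> ^ k + \<bar>\<mu>\<bar> ^ k))"
        by (intro AE_I2) (simp add: order_trans[OF _ abs_ge_self])
    qed
  next
    case 2
    show ?thesis
      by (rule integrable_const_bound[of _ "\<bar>\<mu>\<bar> ^ k"]) (use 2 in auto)
  qed
qed

lemma std_normal_cos:
  assumes "prob_space M" and N: "distributed M lborel N std_normal_density"
  shows "(\<integral>w. cos (t * N w + c) \<partial>M) = cos c * exp (- t\<^sup>2 / 2)"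
proof -
  interpret prob_space M by fact
  interpret R: real_distribution std_normal_distribution by (rule real_dist_normal_dist)
  have Nm: "N \<in> borel_measurable M" using distributed_measurable[OF N] by simp
  have D: "distr M lborel N = std_normal_distribution"
    using N by (simp add: distributed_def)
  have int: "integrable std_normal_distribution (\<lambda>x. iexp (t * x))"
    by (rule R.integrable_iexp) (auto intro!: borel_measurable_of_real)
  have C: "(CLINT x|std_normal_distribution. iexp (t * x)) = complex_of_real (exp (- t\<^sup>2 / 2))"
    using char_std_normal_distribution unfolding char_def by metis
  have re: "(\<integral>x. cos (t * x) \<partial>std_normal_distribution) = exp (- t\<^sup>2 / 2)"
    using arg_cong[OF C, of Re] integral_Re[OF int] by (simp add: Re_exp)
  have im: "(\<integral>x. sin (t * x) \<partial>std_normal_distribution) = 0"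
    using arg_cong[OF C, of Im] integral_Im[OF int] by (simp add: Im_exp)
  have ints: "integrable std_normal_distribution (\<lambda>x. cos (t * x))"
     "integrable std_normal_distribution (\<lambda>x. sin (t * x))"
    by (auto intro!: R.integrable_const_bound[of _ 1])
  have "(\<integral>w. cos (t * N w + c) \<partial>M) = (\<integral>x. cos (t * x + c) \<partial>std_normal_distribution)"
    unfolding D[symmetric] using Nm by (subst integral_distr) auto
  also have "\<dots> = (\<integral>x. cos c * cos (t * x) - sin c * sin (t * x) \<partial>std_normal_distribution)"
    by (simp add: cos_add mult.commute)
  also have "\<dots> = cos c * exp (- t\<^sup>2 / 2)"
    using ints re im by simp
  finally show ?thesis .
qed

text \<open>
  The number \<open>v\<close> is the variance. It enters only through \<open>t\<^sup>2 v\<close>, which is why rescaling time by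
  square roots turns sums of independent copies into a semigroup below. A degenerate law is covered
  by \<open>v = 0\<close>.
\<close>

lemma gaussian_rv_cos:
  assumes "prob_space M" and Z: "gaussian_rv M Z" and mean: "(\<integral>w. Z w \<partial>M) = 0"
  obtains v where "\<And>t c. (\<integral>w. cos (t * Z w + c) \<partial>M) = cos c * exp (- (t\<^sup>2 * v) / 2)"
proof -
  interpret prob_space M by fact
  from Z consider \<mu> \<sigma> where "0 < \<sigma>" "distributed M lborel Z (normal_density \<mu> \<sigma>)"
    | \<mu> where "Z \<in> borel_measurable M" "AE w in M. Z w = \<mu>"
    unfolding gaussian_rv_def by blast
  then show ?thesis
  proof cases
    case 1
    have "\<mu> = 0" using normal_distributed_expectation[OF 1] mean by simp
    then have N: "distributed M lborel (\<lambda>w. Z w / \<sigma>) std_normal_density"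
      using normal_standard_normal_convert[OF 1(1), of Z \<mu>] 1(2) by simp
    have "(\<integral>w. cos (t * Z w + c) \<partial>M) = cos c * exp (- (t\<^sup>2 * \<sigma>\<^sup>2) / 2)" for t c
      using std_normal_cos[OF assms(1) N, of "t * \<sigma>" c] 1(1) by (simp add: power_mult_distrib)
    then show ?thesis by (rule that)
  next
    case 2
    have "(\<integral>w. Z w \<partial>M) = (\<integral>w. \<mu> \<partial>M)" using 2 by (intro integral_cong_AE) auto
    then have "\<mu> = 0" using mean by (simp add: prob_space)
    have "(\<integral>w. cos (t * Z w + c) \<partial>M) = (\<integral>w. cos c \<partial>M)" for t c
      using 2 \<open>\<mu> = 0\<close> by (intro integral_cong_AE) auto
    then show ?thesis by (intro that[of 0]) (simp add: prob_space)
  qed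
qed

lemma gaussian_vector_component:
  "gaussian_vector M X \<Longrightarrow> gaussian_rv M (\<lambda>w. X w $ j)"
  unfolding gaussian_vector_def by (drule conjunct2, drule spec[of _ "axis j 1"]) (simp add: inner_axis')

text \<open>
  First moments make Lipschitz functions integrable, second moments give the covariances, and third
  moments control the remainder of the second-order Taylor expansion.
\<close>

lemma gaussian_vector_integrable:
  fixes X :: "'w \<Rightarrow> real ^ 'n"
  assumes "prob_space M" and X: "gaussian_vector M X"
  shows "integrable M X"
    and "integrable M (\<lambda>w. X w $ j * X w $ k)"
    and "integrable M (\<lambda>w. norm (X w) ^ 3)"
proof -
  have [measurable]: "X \<in> borel_measurable M" using X by (simp add: gaussian_vector_def)
  have [measurable]: "(\<lambda>w. X w $ i) \<in> borel_measurable M" for i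
    by (rule measurable_compose[OF \<open>X \<in> borel_measurable M\<close> borel_measurable_continuous_onI])
      (intro continuous_intros)
  note pow = gaussian_rv_integrable_power[OF assms(1) gaussian_vector_component[OF X]]
  show "integrable M X"
  proof (rule Bochner_Integration.integrable_bound)
    show "integrable M (\<lambda>w. \<Sum>j\<in>UNIV. \<bar>X w $ j\<bar>)" using pow[of _ 1] by simp
    show "AE w in M. norm (X w) \<le> norm (\<Sum>j\<in>UNIV. \<bar>X w $ j\<bar>)"
      by (intro AE_I2) (simp add: norm_le_l1_cart order_trans[OF norm_le_l1_cart abs_ge_self])
  qed simp
  show "integrable M (\<lambda>w. X w $ j * X w $ k)"
  proof (rule Bochner_Integration.integrable_bound)
    show "integrable M (\<lambda>w. \<bar>X w $ j\<bar> ^ 2 + \<bar>X w $ k\<bar> ^ 2)"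
      by (intro Bochner_Integration.integrable_add pow)
    have "\<bar>a * b\<bar> \<le> a\<^sup>2 + b\<^sup>2" for a b :: real
    proof -
      have "0 \<le> (\<bar>a\<bar> - \<bar>b\<bar>)\<^sup>2" by simp
      then have "2 * (\<bar>a\<bar> * \<bar>b\<bar>) \<le> a\<^sup>2 + b\<^sup>2" by (simp add: power2_diff)
      moreover have "0 \<le> \<bar>a\<bar> * \<bar>b\<bar>" by simp
      ultimately show ?thesis unfolding abs_mult by linarith
    qed
    then show "AE w in M. norm (X w $ j * X w $ k) \<le> norm (\<bar>X w $ j\<bar> ^ 2 + \<bar>X w $ k\<bar> ^ 2)"
      by (intro AE_I2) simp
  qed measurable
  let ?p = "real CARD('n)"
  show "integrable M (\<lambda>w. norm (X w) ^ 3)"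
  proof (rule Bochner_Integration.integrable_bound)
    show "integrable M (\<lambda>w. ?p ^ 3 * (\<Sum>j\<in>UNIV. \<bar>X w $ j\<bar> ^ 3))" using pow by simp
    have "norm x ^ 3 \<le> ?p ^ 3 * (\<Sum>j\<in>UNIV. \<bar>x $ j\<bar> ^ 3)" for x :: "real ^ 'n"
    proof -
      define m where "m = Max (range (\<lambda>j. \<bar>x $ j\<bar>))"
      have "m \<in> range (\<lambda>j. \<bar>x $ j\<bar>)" unfolding m_def by (rule Max_in) auto
      then obtain i where i: "m = \<bar>x $ i\<bar>" by blast
      have "norm x \<le> (\<Sum>j\<in>UNIV. \<bar>x $ j\<bar>)" by (rule norm_le_l1_cart)
      also have "\<dots> \<le> ?p * m" by (rule sum_bounded_above) (auto simp: m_def)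
      finally have "norm x ^ 3 \<le> (?p * m) ^ 3" by (rule power_mono) simp
      also have "\<dots> = ?p ^ 3 * m ^ 3" by (rule power_mult_distrib)
      also have "m ^ 3 \<le> (\<Sum>j\<in>UNIV. \<bar>x $ j\<bar> ^ 3)"
        unfolding i by (rule member_le_sum[of i UNIV "\<lambda>j. \<bar>x $ j\<bar> ^ 3"]) auto
      finally show ?thesis by simp
    qed
    then show "AE w in M. norm (norm (X w) ^ 3) \<le> norm (?p ^ 3 * (\<Sum>j\<in>UNIV. \<bar>X w $ j\<bar> ^ 3))"
      by (intro AE_I2) (simp add: order_trans[OF _ abs_ge_self])
  qed measurable
qed

lemma centered_mean_inner:
  assumes "integrable M X" "centered M X"
  shows "(\<integral>w. a \<bullet> X w \<partial>M) = 0"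
proof -
  have "integrable M (\<lambda>w. X w $ j)" for j
    by (rule integrable_bounded_linear[OF bounded_linear_vec_nth assms(1)])
  then show ?thesis using assms(2) by (simp add: inner_vec_def centered_def)
qed

lemma covariance_matrix_centered:
  "centered M X \<Longrightarrow> covariance_matrix M X $ j $ k = (\<integral>w. X w $ j * X w $ k \<partial>M)"
  by (simp add: covariance_matrix_def covariance_def centered_def)

section \<open>The Gaussian semigroups\<close>

lemma integrable_pair_fst_snd:
  fixes U :: "'w \<Rightarrow> 'a::{banach, second_countable_topology}" and V :: "'v \<Rightarrow> 'b::{banach, second_countable_topology}"
  assumes "prob_space M" "prob_space N"
  shows "integrable M U \<Longrightarrow> integrable (M \<Otimes>\<^sub>M N) (\<lambda>p. U (fst p))"
    and "integrable N V \<Longrightarrow> integrable (M \<Otimes>\<^sub>M N) (\<lambda>p. V (snd p))"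
proof -
  have fst: "integrable (P \<Otimes>\<^sub>M Q) (\<lambda>p. W (fst p))"
    if "prob_space P" "prob_space Q" "integrable P W"
    for P :: "'p measure" and Q :: "'q measure" and W :: "'p \<Rightarrow> 'c::{banach, second_countable_topology}"
  proof -
    have "distr (P \<Otimes>\<^sub>M Q) P fst = P" by (rule prob_space.distr_pair_fst[OF that(2)])
    then show ?thesis using integrable_distr[OF measurable_fst, of P Q W] that(3) by simp
  qed
  show "integrable M U \<Longrightarrow> integrable (M \<Otimes>\<^sub>M N) (\<lambda>p. U (fst p))" by (rule fst[OF assms])
  interpret pair_prob_space M N using assms by (simp add: pair_prob_space_def pair_sigma_finite_def prob_space_imp_sigma_finite)
  assume "integrable N V"
  from fst[OF assms(2,1) this] have "integrable (N \<Otimes>\<^sub>M M) (\<lambda>p. V (fst p))" .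
  then show "integrable (M \<Otimes>\<^sub>M N) (\<lambda>p. V (snd p))"
    using integrable_product_swap_iff[of "\<lambda>p. V (snd p)"] by (simp add: case_prod_unfold)
qed

text \<open>
  The transition operators of the Brownian motion with the covariance of \<open>X\<close>. Working with operators
  on functions replaces the independent copies of \<open>X\<close> and \<open>Y\<close> that an interpolation between the two
  laws would need; in particular \<open>X\<close> and \<open>Y\<close> may live on one space with an arbitrary joint law.
\<close>

definition smear :: "'w measure \<Rightarrow> ('w \<Rightarrow> 'a::euclidean_space) \<Rightarrow> real \<Rightarrow> ('a \<Rightarrow> real) \<Rightarrow> 'a \<Rightarrow> real" where
  "smear M X s f x = (\<integral>w. f (x + sqrt s *\<^sub>R X w) \<partial>M)"

lemma integrable_smear:
  fixes X :: "'w \<Rightarrow> 'a::euclidean_space" and f :: "'a \<Rightarrow> real"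
  assumes "prob_space M" and X: "integrable M X" and f: "C-lipschitz_on UNIV f"
  shows "integrable M (\<lambda>w. f (x + c *\<^sub>R X w))"
proof (rule integrable_lipschitz[OF assms(1) _ f])
  interpret prob_space M by fact
  show "integrable M (\<lambda>w. x + c *\<^sub>R X w)" using X by simp
qed

text \<open>
  Averaging does not increase a uniform distance. The shift \<open>a\<close> serves the Lipschitz bound, where
  \<open>f\<close> is compared with its own translate; the telescoping argument takes \<open>a = 0\<close>.
\<close>

lemma smear_diff_le:
  fixes X :: "'w \<Rightarrow> 'a::euclidean_space"
  assumes M: "prob_space M" and X: "integrable M X"
    and f: "C-lipschitz_on UNIV f" and g: "C'-lipschitz_on UNIV g"
    and D: "\<And>x. \<bar>f x - g (a + x)\<bar> \<le> D"
  shows "\<bar>smear M X s f x - smear M X s g (a + x)\<bar> \<le> D"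
proof -
  interpret prob_space M by fact
  note i = integrable_smear[OF M X f, of x "sqrt s"] integrable_smear[OF M X g, of "a + x" "sqrt s"]
  have "\<bar>smear M X s f x - smear M X s g (a + x)\<bar> = \<bar>\<integral>w. f (x + sqrt s *\<^sub>R X w) - g (a + x + sqrt s *\<^sub>R X w) \<partial>M\<bar>"
    unfolding smear_def using i by simp
  also have "\<dots> \<le> (\<integral>w. \<bar>f (x + sqrt s *\<^sub>R X w) - g (a + x + sqrt s *\<^sub>R X w)\<bar> \<partial>M)"
    by (rule integral_abs_bound)
  also have "\<dots> \<le> (\<integral>w. D \<partial>M)"
    using i D[of "x + sqrt s *\<^sub>R X w" for w] by (intro integral_mono) (auto simp: add.assoc)
  finally show ?thesis by (simp add: prob_space)
qed

lemma smear_lipschitz: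
  fixes X :: "'w \<Rightarrow> 'a::euclidean_space"
  assumes M: "prob_space M" and X: "integrable M X" and f: "C-lipschitz_on UNIV f"
  shows "C-lipschitz_on UNIV (smear M X s f)"
proof (rule lipschitz_onI)
  fix x y :: 'a
  have "\<bar>smear M X s f x - smear M X s f ((y - x) + x)\<bar> \<le> C * norm (x - y)"
  proof (rule smear_diff_le[OF M X f f])
    show "\<bar>f z - f ((y - x) + z)\<bar> \<le> C * norm (x - y)" for z
      using lipschitz_on_growth(1)[OF f, of z "(y - x) + z"] by simp
  qed
  then show "dist (smear M X s f x) (smear M X s f y) \<le> C * dist x y"
    by (simp add: dist_norm)
qed (rule lipschitz_on_nonneg[OF f])

text \<open>
  Both sides average \<open>f\<close> over the product of the two laws, whatever the joint law of \<open>X\<close> and \<open>Y\<close>.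
\<close>

lemma smear_commute:
  fixes X :: "'w \<Rightarrow> 'a::euclidean_space" and Y :: "'v \<Rightarrow> 'a"
  assumes M: "prob_space M" and X: "integrable M X" and N: "prob_space N" and Y: "integrable N Y"
    and f: "C-lipschitz_on UNIV f"
  shows "smear M X s (smear N Y t f) x = smear N Y t (smear M X s f) x"
proof -
  interpret pair_prob_space M N
    using assms by (simp add: pair_prob_space_def pair_sigma_finite_def prob_space_imp_sigma_finite)
  have int: "integrable (M \<Otimes>\<^sub>M N) (\<lambda>p. f (x + sqrt s *\<^sub>R X (fst p) + sqrt t *\<^sub>R Y (snd p)))"
    using integrable_pair_fst_snd(1)[OF M N X] integrable_pair_fst_snd(2)[OF M N Y]
    by (intro integrable_lipschitz[OF P.prob_space_axioms _ f]) simp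
  have "(\<integral>v. \<integral>w. f (x + sqrt s *\<^sub>R X w + sqrt t *\<^sub>R Y v) \<partial>M \<partial>N) =
      (\<integral>w. \<integral>v. f (x + sqrt s *\<^sub>R X w + sqrt t *\<^sub>R Y v) \<partial>N \<partial>M)"
    using int by (intro Fubini_integral) (simp add: case_prod_unfold)
  then show ?thesis
    unfolding smear_def by (simp add: add_ac)
qed

text \<open>
  The semigroup law. For independent copies \<open>X\<close> and \<open>X'\<close>, the vectors \<open>sqrt s X + sqrt t X'\<close> and
  \<open>sqrt (s + t) X\<close> have the same cosine integrals because variances add; the
  projections then determine the expectation of \<open>f\<close>.
\<close>

lemma smear_smear:
  fixes X :: "'w \<Rightarrow> real ^ 'n"
  assumes M: "prob_space M" and X: "gaussian_vector M X" and "centered M X"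
    and f: "C-lipschitz_on UNIV f" and st: "0 \<le> s" "0 \<le> t"
  shows "smear M X s (smear M X t f) x = smear M X (s + t) f x"
proof -
  interpret pair_prob_space M M
    using M by (simp add: pair_prob_space_def pair_sigma_finite_def prob_space_imp_sigma_finite)
  note Xi = gaussian_vector_integrable(1)[OF M X]
  define U where "U p = x + sqrt s *\<^sub>R X (fst p) + sqrt t *\<^sub>R X (snd p)" for p
  have U: "integrable (M \<Otimes>\<^sub>M M) U"
    unfolding U_def using integrable_pair_fst_snd(1)[OF M M Xi] integrable_pair_fst_snd(2)[OF M M Xi] by simp
  have V: "integrable M (\<lambda>w. x + sqrt (s + t) *\<^sub>R X w)" using Xi by simp
  have "(\<integral>p. cos (a \<bullet> U p + b) \<partial>(M \<Otimes>\<^sub>M M)) = (\<integral>w. cos (a \<bullet> (x + sqrt (s + t) *\<^sub>R X w) + b) \<partial>M)" for a b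
  proof -
    have "gaussian_rv M (\<lambda>w. a \<bullet> X w)" using X by (simp add: gaussian_vector_def)
    then obtain v where v: "\<And>r c. (\<integral>w. cos (r * (a \<bullet> X w) + c) \<partial>M) = cos c * exp (- (r\<^sup>2 * v) / 2)"
      using gaussian_rv_cos[OF M _ centered_mean_inner[OF Xi \<open>centered M X\<close>]] by blast
    have "integrable (M \<Otimes>\<^sub>M M) (\<lambda>p. cos (a \<bullet> U p + b))"
      by (rule trig_poly_integrable[OF P.prob_space_axioms borel_measurable_integrable[OF U] trig_poly.cosine])
    then have "(\<integral>p. cos (a \<bullet> U p + b) \<partial>(M \<Otimes>\<^sub>M M)) = (\<integral>w. \<integral>w'. cos (a \<bullet> U (w, w') + b) \<partial>M \<partial>M)"
      by (rule integral_fst'[symmetric])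
    also have "\<dots> = (\<integral>w. \<integral>w'. cos (sqrt t * (a \<bullet> X w') + (sqrt s * (a \<bullet> X w) + (a \<bullet> x + b))) \<partial>M \<partial>M)"
      by (simp add: U_def inner_add_right add_ac)
    also have "\<dots> = cos (a \<bullet> x + b) * exp (- ((sqrt s)\<^sup>2 * v) / 2) * exp (- ((sqrt t)\<^sup>2 * v) / 2)"
      unfolding v by (simp add: v)
    also have "\<dots> = cos (a \<bullet> x + b) * exp (- ((sqrt (s + t))\<^sup>2 * v) / 2)"
      using st by (simp add: exp_add[symmetric] algebra_simps add_divide_distrib)
    also have "\<dots> = (\<integral>w. cos (sqrt (s + t) * (a \<bullet> X w) + (a \<bullet> x + b)) \<partial>M)"
      unfolding v ..
    finally show ?thesis by (simp add: inner_add_right add_ac)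
  qed
  then have "(\<integral>p. f (U p) \<partial>(M \<Otimes>\<^sub>M M)) = smear M X (s + t) f x"
    unfolding smear_def by (rule integral_eq_if_cos_integrals_eq[OF P.prob_space_axioms U M V _ f])
  moreover have "(\<integral>p. f (U p) \<partial>(M \<Otimes>\<^sub>M M)) = smear M X s (smear M X t f) x"
    unfolding smear_def U_def
    using integral_fst'[OF integrable_lipschitz[OF P.prob_space_axioms U f]] by (simp add: U_def)
  ultimately show ?thesis by simp
qed

lemma smear_0: "prob_space M \<Longrightarrow> smear M X 0 f = f"
  by (rule ext) (simp add: smear_def prob_space.prob_space)

text \<open>
  Lindeberg's replacement argument. Write \<open>P\<close> and \<open>Q\<close> for the two operators at time \<open>h\<close>. In
  \<open>P ^ (k + 1) - Q ^ (k + 1) = P ^ k (P - Q) + Q (P ^ k - Q ^ k)\<close> the last summand uses that \<open>P\<close> and \<open>Q\<close> commute, and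
  every further application of \<open>P\<close> or \<open>Q\<close> is a contraction in the uniform norm. Thus each of the \<open>k\<close> replacements
  costs at most \<open>D\<close>.
\<close>

lemma smear_telescope:
  fixes X Y :: "'w \<Rightarrow> real ^ 'n"
  assumes M: "prob_space M" and X: "gaussian_vector M X" "centered M X"
    and Y: "gaussian_vector M Y" "centered M Y"
    and f: "C-lipschitz_on UNIV f" and h: "0 \<le> h"
    and step: "\<And>x. \<bar>smear M X h f x - smear M Y h f x\<bar> \<le> D"
  shows "\<bar>smear M X (real k * h) f x - smear M Y (real k * h) f x\<bar> \<le> real k * D"
proof (induction k arbitrary: x)
  case 0
  show ?case by (simp add: smear_0[OF M])
next
  case (Suc k)
  let ?k = "real k * h"
  note Xi = gaussian_vector_integrable(1)[OF M X(1)] and Yi = gaussian_vector_integrable(1)[OF M Y(1)]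
  note lX = smear_lipschitz[OF M Xi f] and lY = smear_lipschitz[OF M Yi f]
  have k: "0 \<le> ?k" using h by simp
  have split: "real (Suc k) * h = ?k + h" "real (Suc k) * h = h + ?k"
    by (simp_all add: algebra_simps)
  have "\<bar>smear M X ?k (smear M X h f) x - smear M X ?k (smear M Y h f) x\<bar> \<le> D"
    using smear_diff_le[OF M Xi lX lY, of h h 0 D ?k x] step by simp
  moreover have "\<bar>smear M Y h (smear M X ?k f) x - smear M Y h (smear M Y ?k f) x\<bar> \<le> real k * D"
    using smear_diff_le[OF M Yi lX lY, of ?k ?k 0 "real k * D" h x] Suc.IH by simp
  moreover have "smear M X (real (Suc k) * h) f x = smear M X ?k (smear M X h f) x"
    unfolding split(1) by (rule smear_smear[OF M X f k h, symmetric])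
  moreover have "smear M Y (real (Suc k) * h) f x = smear M Y h (smear M Y ?k f) x"
    unfolding split(2) by (rule smear_smear[OF M Y f h k, symmetric])
  moreover have "smear M X ?k (smear M Y h f) x = smear M Y h (smear M X ?k f) x"
    by (rule smear_commute[OF M Xi M Yi f])
  ultimately show ?case by (simp add: algebra_simps) 
qed

section \<open>Comparison of two Gaussian vectors\<close>

text \<open>
  The mean of the linear term vanishes, the mean of the quadratic form is its contraction with the
  covariance matrix, and the remainder is cubic in \<open>sqrt h X\<close>.
\<close>

lemma smear_expansion:
  fixes X :: "'w \<Rightarrow> real ^ 'n"
  assumes M: "prob_space M" and X: "gaussian_vector M X" "centered M X"
    and f: "C-lipschitz_on UNIV f" and h: "0 \<le> h"
    and taylor: "\<And>v. \<bar>f (x + v) - f x - a \<bullet> v - (\<Sum>j\<in>UNIV. \<Sum>k\<in>UNIV. H $ j $ k * (v $ j * v $ k)) / 2\<bar>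
      \<le> K * norm v ^ 3"
  shows "\<bar>smear M X h f x - (f x + h / 2 * (\<Sum>j\<in>UNIV. \<Sum>k\<in>UNIV. H $ j $ k * covariance_matrix M X $ j $ k))\<bar>
    \<le> K * (h * sqrt h) * (\<integral>w. norm (X w) ^ 3 \<partial>M)"
proof -
  interpret prob_space M by fact
  note int = gaussian_vector_integrable[OF M X(1)]
  define Q where "Q v = (\<Sum>j\<in>UNIV. \<Sum>k\<in>UNIV. H $ j $ k * (v $ j * v $ k))" for v :: "real ^ 'n"
  define R where "R w = f (x + sqrt h *\<^sub>R X w) - f x - sqrt h * (a \<bullet> X w) - h / 2 * Q (X w)" for w
  have Q_scale: "Q (sqrt h *\<^sub>R v) = h * Q v" for v
  proof -
    have scale: "(sqrt h * s) * (sqrt h * t) = h * (s * t)" for s t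
    proof -
      have "(sqrt h * s) * (sqrt h * t) = (sqrt h * sqrt h) * (s * t)" by (simp only: mult_ac)
      then show ?thesis using h by simp
    qed
    show ?thesis
      unfolding Q_def vector_scaleR_component real_scaleR_def scale
      by (simp only: sum_distrib_left mult.left_commute[of _ h])
  qed
  have Q_int: "integrable M (\<lambda>w. Q (X w))" unfolding Q_def using int(2) by simp
  have Q_mean: "(\<integral>w. Q (X w) \<partial>M) = (\<Sum>j\<in>UNIV. \<Sum>k\<in>UNIV. H $ j $ k * covariance_matrix M X $ j $ k)"
    unfolding Q_def using int(2) by (simp add: covariance_matrix_centered[OF X(2)])
  have f_int: "integrable M (\<lambda>w. f (x + sqrt h *\<^sub>R X w))" by (rule integrable_smear[OF M int(1) f])
  have a_int: "integrable M (\<lambda>w. a \<bullet> X w)" using int(1) by simp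
  have R_int: "integrable M R"
    unfolding R_def[abs_def] using f_int Q_int a_int by simp
  have "(\<integral>w. R w \<partial>M) = smear M X h f x - (f x + h / 2 * (\<integral>w. Q (X w) \<partial>M))"
    unfolding R_def smear_def using f_int Q_int a_int
    by (simp add: prob_space centered_mean_inner[OF int(1) X(2)])
  moreover have "\<bar>\<integral>w. R w \<partial>M\<bar> \<le> (\<integral>w. K * (h * sqrt h) * norm (X w) ^ 3 \<partial>M)"
  proof (rule order_trans[OF integral_abs_bound integral_mono])
    show "integrable M (\<lambda>w. \<bar>R w\<bar>)" using R_int by simp
    show "integrable M (\<lambda>w. K * (h * sqrt h) * norm (X w) ^ 3)" using int(3) by simp
    have cube: "sqrt h ^ 3 = h * sqrt h"
      using h by (simp add: power3_eq_cube)
    show "\<bar>R w\<bar> \<le> K * (h * sqrt h) * norm (X w) ^ 3" for w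
      using taylor[of "sqrt h *\<^sub>R X w"] h unfolding Q_def[symmetric] Q_scale
      by (simp add: R_def power_mult_distrib cube)
  qed
  ultimately show ?thesis by (simp add: Q_mean)
qed

text \<open>
  Over a time step \<open>h = 1/n\<close> the two operators differ by at most \<open>h B \<Delta> / 2 + O(h sqrt h)\<close>, since their expansions
  agree but for the covariances. The \<open>n\<close> replacements that lead from \<open>X\<close> to \<open>Y\<close> at time \<open>1\<close> add up
  to \<open>B \<Delta> / 2 + O(1 / sqrt n)\<close>. The constants \<open>K\<close> and \<open>B\<close> must not depend on the point of expansion \<open>x\<close>.
\<close>

lemma gaussian_comparison:
  fixes X Y :: "'w \<Rightarrow> real ^ 'n"
  assumes M: "prob_space M" and X: "gaussian_vector M X" "centered M X"
    and Y: "gaussian_vector M Y" "centered M Y"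
    and f: "C-lipschitz_on UNIV f"
    and taylor: "\<And>x. \<exists>a H. (\<forall>v. \<bar>f (x + v) - f x - a \<bullet> v
         - (\<Sum>j\<in>UNIV. \<Sum>k\<in>UNIV. H $ j $ k * (v $ j * v $ k)) / 2\<bar> \<le> K * norm v ^ 3)
       \<and> (\<Sum>j\<in>UNIV. \<Sum>k\<in>UNIV. \<bar>H $ j $ k\<bar>) \<le> B"
    and \<Delta>: "\<And>j k. \<bar>covariance_matrix M X $ j $ k - covariance_matrix M Y $ j $ k\<bar> \<le> \<Delta>"
  shows "\<bar>(\<integral>w. f (X w) \<partial>M) - (\<integral>w. f (Y w) \<partial>M)\<bar> \<le> B / 2 * \<Delta>"
proof -
  define E where "E = K * (\<integral>w. norm (X w) ^ 3 \<partial>M) + K * (\<integral>w. norm (Y w) ^ 3 \<partial>M)"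
  have \<Delta>0: "0 \<le> \<Delta>" using \<Delta> by (meson abs_ge_zero order_trans)
  have step: "\<bar>smear M X h f x - smear M Y h f x\<bar> \<le> h * (B / 2 * \<Delta>) + h * sqrt h * E"
    if h: "0 \<le> h" for h x
  proof -
    obtain a H where aH: "\<And>v. \<bar>f (x + v) - f x - a \<bullet> v
         - (\<Sum>j\<in>UNIV. \<Sum>k\<in>UNIV. H $ j $ k * (v $ j * v $ k)) / 2\<bar> \<le> K * norm v ^ 3"
      and HB: "(\<Sum>j\<in>UNIV. \<Sum>k\<in>UNIV. \<bar>H $ j $ k\<bar>) \<le> B"
      using taylor[of x] by blast
    define cX where "cX = (\<Sum>j\<in>UNIV. \<Sum>k\<in>UNIV. H $ j $ k * covariance_matrix M X $ j $ k)"
    define cY where "cY = (\<Sum>j\<in>UNIV. \<Sum>k\<in>UNIV. H $ j $ k * covariance_matrix M Y $ j $ k)"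
    have "\<bar>cX - cY\<bar> = \<bar>\<Sum>j\<in>UNIV. \<Sum>k\<in>UNIV. H $ j $ k * (covariance_matrix M X $ j $ k - covariance_matrix M Y $ j $ k)\<bar>"
      by (simp add: cX_def cY_def sum_subtractf right_diff_distrib)
    also have "\<dots> \<le> (\<Sum>j\<in>UNIV. \<Sum>k\<in>UNIV. \<bar>H $ j $ k\<bar> * \<Delta>)"
      by (intro order_trans[OF sum_abs] sum_mono) (simp add: abs_mult mult_left_mono \<Delta>)
    also have "\<dots> = (\<Sum>j\<in>UNIV. \<Sum>k\<in>UNIV. \<bar>H $ j $ k\<bar>) * \<Delta>"
      by (simp add: sum_distrib_right)
    also have "\<dots> \<le> B * \<Delta>" using HB \<Delta>0 by (rule mult_right_mono)
    finally have "h / 2 * \<bar>cX - cY\<bar> \<le> h / 2 * (B * \<Delta>)"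
      using h by (intro mult_left_mono) auto
    then have "\<bar>h / 2 * cX - h / 2 * cY\<bar> \<le> h * (B / 2 * \<Delta>)"
      unfolding right_diff_distrib[symmetric] abs_mult using h by simp
    moreover have "h * sqrt h * E = K * (h * sqrt h) * (\<integral>w. norm (X w) ^ 3 \<partial>M) + K * (h * sqrt h) * (\<integral>w. norm (Y w) ^ 3 \<partial>M)"
      by (simp add: E_def algebra_simps)
    ultimately show ?thesis
      using smear_expansion[OF M X f h aH] smear_expansion[OF M Y f h aH]
      unfolding cX_def[symmetric] cY_def[symmetric] by linarith
  qed
  have bound: "\<bar>(\<integral>w. f (X w) \<partial>M) - (\<integral>w. f (Y w) \<partial>M)\<bar> \<le> B / 2 * \<Delta> + sqrt (1 / real (Suc n)) * E" for n
  proof -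
    define h where "h = 1 / real (Suc n)"
    have h: "0 \<le> h" "real (Suc n) * h = 1" by (simp_all add: h_def)
    have "\<bar>smear M X 1 f 0 - smear M Y 1 f 0\<bar> \<le> real (Suc n) * (h * (B / 2 * \<Delta>) + h * sqrt h * E)"
      using smear_telescope[OF M X Y f h(1) step[OF h(1)], of "Suc n" 0] unfolding h(2) .
    also have "\<dots> = (real (Suc n) * h) * (B / 2 * \<Delta> + sqrt h * E)" by (simp only: distrib_left mult.assoc)
    finally show ?thesis unfolding h(2) by (simp add: smear_def h_def)
  qed
  have "(\<lambda>n. B / 2 * \<Delta> + sqrt (1 / real (Suc n)) * E) \<longlonglongrightarrow> B / 2 * \<Delta> + sqrt 0 * E"
    by (intro tendsto_intros LIMSEQ_Suc[OF lim_1_over_n])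
  then have "(\<lambda>n. B / 2 * \<Delta> + sqrt (1 / real (Suc n)) * E) \<longlonglongrightarrow> B / 2 * \<Delta>" by simp
  then show ?thesis by (rule LIMSEQ_le_const) (use bound in blast)
qed

section \<open>Calculus of the smooth maximum\<close>

text \<open>
  The \<open>k\<close>-th moment of the coordinates of \<open>v\<close> under the Gibbs weights \<open>exp (\<beta> z\<^sub>j) / (\<Sum>i. exp (\<beta> z\<^sub>i))\<close>.
  All directional derivatives of \<open>smooth_max\<close> are polynomials in these moments, because
  differentiating a moment along \<open>v\<close> gives \<open>\<beta>\<close> times a covariance under the weights.
\<close>

definition gibbs_moment :: "real \<Rightarrow> real ^ 'n \<Rightarrow> real ^ 'n \<Rightarrow> nat \<Rightarrow> real" where
  "gibbs_moment \<beta> z v k = (\<Sum>j\<in>UNIV. (v $ j) ^ k * exp (\<beta> * z $ j)) / (\<Sum>j\<in>UNIV. exp (\<beta> * z $ j))"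

lemma sum_exp_pos: "0 < (\<Sum>j\<in>UNIV. exp (\<beta> * z $ j :: real))"
  for z :: "real ^ 'n"
  by (rule sum_pos) auto

lemma abs_gibbs_moment_le: "\<bar>gibbs_moment \<beta> z v k\<bar> \<le> norm v ^ k"
proof -
  have "\<bar>\<Sum>j\<in>UNIV. (v $ j) ^ k * exp (\<beta> * z $ j)\<bar> \<le> (\<Sum>j\<in>UNIV. norm v ^ k * exp (\<beta> * z $ j))"
    by (rule order_trans[OF sum_abs])
      (auto intro!: sum_mono mult_right_mono power_mono component_le_norm_cart simp: abs_mult power_abs)
  then show ?thesis
    using sum_exp_pos[of \<beta> z] by (simp add: gibbs_moment_def sum_distrib_left[symmetric] pos_divide_le_eq)
qed

lemma has_real_derivative_gibbs_moment:
  "((\<lambda>r. gibbs_moment \<beta> (x + r *\<^sub>R v) v k) has_real_derivative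
     \<beta> * (gibbs_moment \<beta> (x + r *\<^sub>R v) v (Suc k)
        - gibbs_moment \<beta> (x + r *\<^sub>R v) v k * gibbs_moment \<beta> (x + r *\<^sub>R v) v 1)) (at r)"
proof -
  define S where "S i r = (\<Sum>j\<in>UNIV. (v $ j) ^ i * exp (\<beta> * (x + r *\<^sub>R v) $ j))" for i r
  have S: "(S i has_real_derivative \<beta> * S (Suc i) r) (at r)" for i
    unfolding S_def[abs_def]
    by (auto intro!: derivative_eq_intros sum.cong simp: sum_distrib_left mult_ac)
  have pos: "S 0 r > 0" for r using sum_exp_pos[of \<beta> "x + r *\<^sub>R v"] by (simp add: S_def)
  have m: "gibbs_moment \<beta> (x + r *\<^sub>R v) v i = S i r / S 0 r" for i r
    by (simp add: gibbs_moment_def S_def)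
  show ?thesis
    unfolding m using pos[of r]
    by (auto intro!: derivative_eq_intros S simp: field_simps)
qed

lemma has_real_derivative_smooth_max:
  assumes "\<beta> \<noteq> 0"
  shows "((\<lambda>r. smooth_max \<beta> (x + r *\<^sub>R v)) has_real_derivative gibbs_moment \<beta> (x + r *\<^sub>R v) v 1) (at r)"
proof -
  have "((\<lambda>r. \<Sum>j\<in>UNIV. exp (\<beta> * (x + r *\<^sub>R v) $ j)) has_real_derivative
      \<beta> * (\<Sum>j\<in>UNIV. (v $ j) ^ 1 * exp (\<beta> * (x + r *\<^sub>R v) $ j))) (at r)"
    by (auto intro!: derivative_eq_intros sum.cong simp: sum_distrib_left mult_ac)
  from DERIV_cmult[OF DERIV_chain2[OF DERIV_ln[OF sum_exp_pos] this], of "inverse \<beta>"]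
  show ?thesis
    unfolding smooth_max_def
    by (rule DERIV_cong) (use assms in \<open>simp add: gibbs_moment_def divide_inverse\<close>)
qed

lemma smooth_max_lipschitz:
  assumes \<beta>: "\<beta> > 0"
  shows "1-lipschitz_on UNIV (smooth_max \<beta> :: real ^ 'n \<Rightarrow> real)"
proof -
  have one: "smooth_max \<beta> x - smooth_max \<beta> y \<le> norm (x - y)" for x y :: "real ^ 'n"
  proof -
    have le: "\<beta> * x $ j \<le> \<beta> * norm (x - y) + \<beta> * y $ j" for j
      using component_le_norm_cart[of "x - y" j] \<beta>
      by (simp add: distrib_left[symmetric])
    have "(\<Sum>j\<in>UNIV. exp (\<beta> * x $ j)) \<le> (\<Sum>j\<in>UNIV. exp (\<beta> * norm (x - y)) * exp (\<beta> * y $ j))"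
      using le by (intro sum_mono) (simp add: exp_add[symmetric])
    also have "\<dots> = exp (\<beta> * norm (x - y)) * (\<Sum>j\<in>UNIV. exp (\<beta> * y $ j))"
      by (simp add: sum_distrib_left)
    finally have "ln (\<Sum>j\<in>UNIV. exp (\<beta> * x $ j)) \<le> ln (exp (\<beta> * norm (x - y)) * (\<Sum>j\<in>UNIV. exp (\<beta> * y $ j)))"
      using sum_exp_pos[of \<beta> x] sum_exp_pos[of \<beta> y] by (subst ln_le_cancel_iff) auto
    also have "\<dots> = \<beta> * norm (x - y) + ln (\<Sum>j\<in>UNIV. exp (\<beta> * y $ j))"
      using sum_exp_pos[of \<beta> y] by (subst ln_mult) auto
    finally show ?thesis
      using \<beta> by (simp add: smooth_max_def field_simps)
  qed
  show ?thesis
  proof (rule lipschitz_onI)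
    show "dist (smooth_max \<beta> x) (smooth_max \<beta> y) \<le> 1 * dist x y" for x y :: "real ^ 'n"
      using one[of x y] one[of y x] by (simp add: dist_norm norm_minus_commute)
  qed simp
qed

lemma max_component_lipschitz: "1-lipschitz_on UNIV (max_component :: real ^ 'n \<Rightarrow> real)"
proof -
  have one: "max_component x \<le> norm (x - y) + max_component y" for x y :: "real ^ 'n"
    unfolding max_component_def
  proof (rule Max.boundedI)
    fix a assume "a \<in> range (($) x)"
    then obtain j where j: "a = x $ j" by blast
    have "y $ j \<le> Max (range (($) y))" by simp
    then show "a \<le> norm (x - y) + Max (range (($) y))"
      using component_le_norm_cart[of "x - y" j] unfolding j vector_minus_component by linarith
  qed auto
  show ?thesis
  proof (rule lipschitz_onI)
    show "dist (max_component x) (max_component y) \<le> 1 * dist x y" for x y :: "real ^ 'n"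
      using one[of x y] one[of y x] by (simp add: dist_norm norm_minus_commute)
  qed simp
qed

text \<open>
  The sum of exponentials lies between its largest term and \<open>CARD('n)\<close> times that term.
\<close>

lemma max_component_smooth_max:
  fixes z :: "real ^ 'n"
  assumes \<beta>: "\<beta> > 0"
  shows "\<bar>max_component z - smooth_max \<beta> z\<bar> \<le> inverse \<beta> * ln (real CARD('n))"
proof -
  let ?m = "max_component z" and ?S = "\<Sum>j\<in>UNIV. exp (\<beta> * z $ j)"
  have "?m \<in> range (\<lambda>j. z $ j)" unfolding max_component_def by (rule Max_in) auto
  then obtain i where i: "?m = z $ i" by blast
  have "exp (\<beta> * ?m) \<le> ?S"
    unfolding i by (rule member_le_sum[of i UNIV "\<lambda>j. exp (\<beta> * z $ j)"]) auto
  then have lo: "\<beta> * ?m \<le> ln ?S"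
    using sum_exp_pos[of \<beta> z] by (simp add: ln_ge_iff)
  have "?S \<le> real CARD('n) * exp (\<beta> * ?m)"
    using \<beta> by (intro sum_bounded_above) (auto simp: max_component_def)
  then have "ln ?S \<le> ln (real CARD('n) * exp (\<beta> * ?m))"
    using sum_exp_pos[of \<beta> z] by (subst ln_le_cancel_iff) auto
  also have "\<dots> = ln (real CARD('n)) + \<beta> * ?m" by (subst ln_mult) auto
  finally have hi: "ln ?S \<le> ln (real CARD('n)) + \<beta> * ?m" .
  have "?m \<le> smooth_max \<beta> z" using lo \<beta> by (simp add: smooth_max_def field_simps)
  moreover have "smooth_max \<beta> z \<le> ?m + inverse \<beta> * ln (real CARD('n))"
    using hi \<beta> by (simp add: smooth_max_def field_simps)
  ultimately show ?thesis by simp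
qed

text \<open>
  The Hessian of \<open>g \<circ> smooth_max \<beta>\<close> at \<open>z\<close>, when \<open>g1\<close> and \<open>g2\<close> are the first two derivatives of \<open>g\<close>.
\<close>

definition smooth_max_hessian :: "(real \<Rightarrow> real) \<Rightarrow> (real \<Rightarrow> real) \<Rightarrow> real \<Rightarrow> real ^ 'n \<Rightarrow> real ^ 'n ^ 'n" where
  "smooth_max_hessian g1 g2 \<beta> z =
    (let p = (\<lambda>j. exp (\<beta> * z $ j) / (\<Sum>i\<in>UNIV. exp (\<beta> * z $ i))) in
     \<chi> j k. g2 (smooth_max \<beta> z) * (p j * p k)
       + \<beta> * g1 (smooth_max \<beta> z) * ((if j = k then p j else 0) - p j * p k))"

lemma smooth_max_hessian_form:
  fixes v :: "real ^ 'n"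
  shows "(\<Sum>j\<in>UNIV. \<Sum>k\<in>UNIV. smooth_max_hessian g1 g2 \<beta> z $ j $ k * (v $ j * v $ k)) =
    g2 (smooth_max \<beta> z) * (gibbs_moment \<beta> z v 1)\<^sup>2
      + \<beta> * g1 (smooth_max \<beta> z) * (gibbs_moment \<beta> z v 2 - (gibbs_moment \<beta> z v 1)\<^sup>2)"
proof -
  define p where "p j = exp (\<beta> * z $ j) / (\<Sum>i\<in>UNIV. exp (\<beta> * z $ i))" for j
  define a b where "a = g2 (smooth_max \<beta> z)" and "b = \<beta> * g1 (smooth_max \<beta> z)"
  have m: "gibbs_moment \<beta> z v i = (\<Sum>j\<in>UNIV. p j * v $ j ^ i)" for i
    by (simp add: gibbs_moment_def p_def sum_divide_distrib mult.commute)
  have sq: "(\<Sum>j\<in>UNIV. (p j * v $ j) * (\<Sum>k\<in>UNIV. p k * v $ k)) = (gibbs_moment \<beta> z v 1)\<^sup>2"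
    by (simp only: m power2_eq_square sum_distrib_right power_one_right)
  have "smooth_max_hessian g1 g2 \<beta> z $ j $ k * (v $ j * v $ k) =
      (a - b) * ((p j * v $ j) * (p k * v $ k)) + (if j = k then b * (p j * v $ j ^ 2) else 0)" for j k
    by (simp add: smooth_max_hessian_def p_def[symmetric] a_def[symmetric] b_def[symmetric] Let_def
        algebra_simps power2_eq_square)
  then have "(\<Sum>j\<in>UNIV. \<Sum>k\<in>UNIV. smooth_max_hessian g1 g2 \<beta> z $ j $ k * (v $ j * v $ k)) =
      (a - b) * (gibbs_moment \<beta> z v 1)\<^sup>2 + b * gibbs_moment \<beta> z v 2"
    by (simp only: sum.distrib sum_distrib_left[symmetric] sq m[of 2] sum.delta' finite UNIV_I if_True sum.delta)
  then show ?thesis by (simp add: a_def b_def algebra_simps)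
qed

text \<open>
  The bound is free of the dimension since the Gibbs weights \<open>p\<close> sum to one: the entries \<open>p\<^sub>j p\<^sub>k\<close> sum to \<open>1\<close>,
  and the absolute values of the entries of \<open>diag p - p p\<^sup>T\<close> to at most \<open>2\<close>.
\<close>

lemma smooth_max_hessian_abs_sum_le:
  fixes z :: "real ^ 'n"
  assumes "\<beta> > 0" and B1: "\<And>x. \<bar>g1 x\<bar> \<le> B1" and B2: "\<And>x. \<bar>g2 x\<bar> \<le> B2"
  shows "(\<Sum>j\<in>UNIV. \<Sum>k\<in>UNIV. \<bar>smooth_max_hessian g1 g2 \<beta> z $ j $ k\<bar>) \<le> B2 + 2 * \<beta> * B1"
proof -
  define p where "p j = exp (\<beta> * z $ j) / (\<Sum>i\<in>UNIV. exp (\<beta> * z $ i))" for j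
  define a b where "a = g2 (smooth_max \<beta> z)" and "b = \<beta> * g1 (smooth_max \<beta> z)"
  have p: "0 \<le> p j" for j using sum_exp_pos[of \<beta> z] by (simp add: p_def)
  have p1: "(\<Sum>j\<in>UNIV. p j) = 1"
    using sum_exp_pos[of \<beta> z] by (simp add: p_def sum_divide_distrib[symmetric])
  have ab: "\<bar>a\<bar> \<le> B2" "\<bar>b\<bar> \<le> \<beta> * B1"
    using B1 B2 assms(1) by (simp_all add: a_def b_def abs_mult)
  have "\<bar>smooth_max_hessian g1 g2 \<beta> z $ j $ k\<bar> \<le> (B2 + \<beta> * B1) * (p j * p k) + (if j = k then \<beta> * B1 * p j else 0)" for j k
  proof -
    have "smooth_max_hessian g1 g2 \<beta> z $ j $ k = a * (p j * p k) + b * (if j = k then p j else 0) - b * (p j * p k)"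
      by (simp add: smooth_max_hessian_def p_def[symmetric] a_def[symmetric] b_def[symmetric] Let_def
        algebra_simps)
    moreover have "\<bar>a * (p j * p k)\<bar> \<le> B2 * (p j * p k)" "\<bar>b * (p j * p k)\<bar> \<le> \<beta> * B1 * (p j * p k)"
      "\<bar>b * (if j = k then p j else 0)\<bar> \<le> (if j = k then \<beta> * B1 * p j else 0)"
      using ab p by (simp_all add: abs_mult mult_right_mono)
    ultimately show ?thesis unfolding distrib_right by linarith
  qed
  then have "(\<Sum>j\<in>UNIV. \<Sum>k\<in>UNIV. \<bar>smooth_max_hessian g1 g2 \<beta> z $ j $ k\<bar>) \<le>
      (\<Sum>j\<in>UNIV. \<Sum>k\<in>UNIV. (B2 + \<beta> * B1) * (p j * p k) + (if j = k then \<beta> * B1 * p j else 0))"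
    by (intro sum_mono)
  also have "\<dots> = (B2 + \<beta> * B1) + \<beta> * B1"
    by (simp add: sum.distrib sum_distrib_left[symmetric] p1)
  finally show ?thesis by (simp add: algebra_simps)
qed

text \<open>
  Along the line \<open>r \<mapsto> x + r v\<close> the function has three derivatives, and the third is bounded by a
  constant times \<open>norm v ^ 3\<close> because the \<open>k\<close>-th Gibbs moment is at most \<open>norm v ^ k\<close>.
\<close>

lemma smooth_max_taylor:
  fixes x :: "real ^ 'n"
  assumes \<beta>: "\<beta> > 0"
    and g: "\<And>x. (g has_real_derivative g1 x) (at x)" "\<And>x. (g1 has_real_derivative g2 x) (at x)"
      "\<And>x. (g2 has_real_derivative g3 x) (at x)"
    and B: "\<And>x. \<bar>g1 x\<bar> \<le> B1" "\<And>x. \<bar>g2 x\<bar> \<le> B2" "\<And>x. \<bar>g3 x\<bar> \<le> B3"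
  shows "\<bar>g (smooth_max \<beta> (x + v)) - g (smooth_max \<beta> x) - g1 (smooth_max \<beta> x) * gibbs_moment \<beta> x v 1
     - (\<Sum>j\<in>UNIV. \<Sum>k\<in>UNIV. smooth_max_hessian g1 g2 \<beta> x $ j $ k * (v $ j * v $ k)) / 2\<bar>
    \<le> (B3 + 6 * \<beta> * B2 + 6 * \<beta>\<^sup>2 * B1) * norm v ^ 3"
proof -
  define y where "y r = smooth_max \<beta> (x + r *\<^sub>R v)" for r
  define m where "m k r = gibbs_moment \<beta> (x + r *\<^sub>R v) v k" for k r
  \<comment> \<open>The variance of the coordinates of \<open>v\<close> under the Gibbs weights at time \<open>r\<close>, so that \<open>m 1\<close> has
      derivative \<open>\<beta> c\<close>.\<close>
  define c where "c r = m 2 r - m 1 r * m 1 r" for r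
  define d3 where "d3 r = g3 (y r) * (m 1 r * m 1 r * m 1 r) + 3 * \<beta> * g2 (y r) * (m 1 r * c r)
      + \<beta>\<^sup>2 * g1 (y r) * (m 3 r - m 2 r * m 1 r - 2 * (m 1 r * c r))" for r
  define diff where "diff i = (if i = 0 then (\<lambda>r. g (y r)) else if i = 1 then (\<lambda>r. g1 (y r) * m 1 r)
     else if i = 2 then (\<lambda>r. g2 (y r) * (m 1 r * m 1 r) + \<beta> * g1 (y r) * c r) else d3)" for i :: nat
  have y: "(y has_real_derivative m 1 r) (at r)" for r
    unfolding y_def[abs_def] m_def using \<beta> by (intro has_real_derivative_smooth_max) simp
  have m: "(m k has_real_derivative \<beta> * (m (Suc k) r - m k r * m 1 r)) (at r)" for k r
    unfolding m_def[abs_def] by (rule has_real_derivative_gibbs_moment)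
  have m1: "(m 1 has_real_derivative \<beta> * c r) (at r)" for r
    using m[of 1 r] by (simp add: c_def numeral_2_eq_2)
  have c: "(c has_real_derivative \<beta> * (m 3 r - m 2 r * m 1 r - 2 * (m 1 r * c r))) (at r)" for r
    unfolding c_def[abs_def]
    by (rule derivative_eq_intros m[of 2] m1 refl)+ (simp add: c_def algebra_simps eval_nat_numeral)
  note chain = DERIV_chain2[OF g(1) y] DERIV_chain2[OF g(2) y] DERIV_chain2[OF g(3) y]
  have D0: "((\<lambda>r. g (y r)) has_real_derivative g1 (y r) * m 1 r) (at r)" for r
    by (rule chain)
  have D1: "((\<lambda>r. g1 (y r) * m 1 r) has_real_derivative g2 (y r) * (m 1 r * m 1 r) + \<beta> * g1 (y r) * c r) (at r)" for r
    by (rule DERIV_cong[OF DERIV_mult[OF chain(2) m1]]) (simp add: algebra_simps)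
  have D2: "((\<lambda>r. g2 (y r) * (m 1 r * m 1 r) + \<beta> * g1 (y r) * c r) has_real_derivative d3 r) (at r)" for r
    by (rule DERIV_cong[OF DERIV_add[OF DERIV_mult[OF chain(3) DERIV_mult[OF m1 m1]] DERIV_mult[OF DERIV_cmult[OF chain(2)] c]]])
      (simp add: d3_def algebra_simps power2_eq_square)
  have "\<forall>i t. i < 3 \<and> 0 \<le> t \<and> t \<le> (1::real) \<longrightarrow> DERIV (diff i) t :> diff (Suc i) t"
    using D0 D1 D2 by (auto simp: diff_def less_Suc_eq numeral_3_eq_3)
  from Maclaurin2[OF zero_less_one refl this]
  obtain t where t: "diff 0 1 = (\<Sum>i<3. diff i 0 / fact i * 1 ^ i) + diff 3 t / fact 3 * 1 ^ 3" by blast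
  have y0: "y 0 = smooth_max \<beta> x" "y 1 = smooth_max \<beta> (x + v)" "\<And>k. m k 0 = gibbs_moment \<beta> x v k"
    by (simp_all add: y_def m_def)
  have "g (y 1) = g (y 0) + g1 (y 0) * m 1 0 + (g2 (y 0) * (m 1 0 * m 1 0) + \<beta> * g1 (y 0) * c 0) / 2 + d3 t / 6"
    using t by (simp add: diff_def eval_nat_numeral)
  then have eq: "g (smooth_max \<beta> (x + v)) - g (smooth_max \<beta> x) - g1 (smooth_max \<beta> x) * gibbs_moment \<beta> x v 1
     - (\<Sum>j\<in>UNIV. \<Sum>k\<in>UNIV. smooth_max_hessian g1 g2 \<beta> x $ j $ k * (v $ j * v $ k)) / 2 = d3 t / 6"
    unfolding smooth_max_hessian_form y0[symmetric] c_def by (simp add: power2_eq_square)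
  let ?n = "norm v"
  have mk: "\<bar>m k t\<bar> \<le> ?n ^ k" for k unfolding m_def by (rule abs_gibbs_moment_le)
  have mm: "\<bar>a * b\<bar> \<le> ?n ^ i * ?n ^ j" if "\<bar>a\<bar> \<le> ?n ^ i" "\<bar>b\<bar> \<le> ?n ^ j" for a b :: real and i j
    unfolding abs_mult using that by (intro mult_mono) auto
  have m11: "\<bar>m 1 t * m 1 t\<bar> \<le> ?n ^ 2" using mm[OF mk[of 1] mk[of 1]] by (simp add: power2_eq_square)
  have c2: "\<bar>c t\<bar> \<le> 2 * ?n ^ 2" using m11 mk[of 2] unfolding c_def by linarith
  have m111: "\<bar>m 1 t * m 1 t * m 1 t\<bar> \<le> ?n ^ 3"
    using mm[OF m11 mk[of 1]] by (simp add: eval_nat_numeral)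
  have m21: "\<bar>m 2 t * m 1 t\<bar> \<le> ?n ^ 3"
    using mm[OF mk[of 2] mk[of 1]] by (simp add: eval_nat_numeral)
  have m1c: "\<bar>m 1 t * c t\<bar> \<le> 2 * ?n ^ 3"
  proof -
    have "\<bar>m 1 t * c t\<bar> \<le> ?n ^ 1 * (2 * ?n ^ 2)"
      unfolding abs_mult using mk[of 1] c2 by (intro mult_mono) auto
    then show ?thesis by (simp add: eval_nat_numeral)
  qed
  have "\<bar>m 3 t - m 2 t * m 1 t - 2 * (m 1 t * c t)\<bar> \<le> 6 * ?n ^ 3"
    using mk[of 3] m21 m1c by linarith
  then have t3: "\<bar>\<beta>\<^sup>2 * g1 (y t) * (m 3 t - m 2 t * m 1 t - 2 * (m 1 t * c t))\<bar> \<le> (\<beta>\<^sup>2 * B1) * (6 * ?n ^ 3)"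
    unfolding abs_mult using B(1)[of "y t"] \<beta> by (intro mult_mono) auto
  have t2: "\<bar>3 * \<beta> * g2 (y t) * (m 1 t * c t)\<bar> \<le> (3 * \<beta> * B2) * (2 * ?n ^ 3)"
    using B(2)[of "y t"] \<beta> m1c unfolding abs_mult[of _ "m 1 t * c t"] 
    by (intro mult_mono) (auto simp: abs_mult)
  have t1: "\<bar>g3 (y t) * (m 1 t * m 1 t * m 1 t)\<bar> \<le> B3 * ?n ^ 3"
    using B(3)[of "y t"] m111 unfolding abs_mult[of "g3 (y t)"] by (intro mult_mono) auto
  have "\<bar>d3 t\<bar> \<le> (B3 + 6 * \<beta> * B2 + 6 * \<beta>\<^sup>2 * B1) * ?n ^ 3"
    using t1 t2 t3 unfolding d3_def by (simp add: algebra_simps)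
  then show ?thesis unfolding eq by simp
qed

section \<open>Moving averages of the test function\<close>

text \<open>
  The second derivative of \<open>g\<close> need not be uniformly continuous, so the Taylor remainder of \<open>g\<close> itself
  cannot be controlled uniformly. The moving average of \<open>g\<close> over \<open>[x, x + \<delta>]\<close> gains one derivative. Its
  first two derivatives are difference quotients of \<open>g\<close> and its derivative, so by the mean value
  theorem they obey the same bounds; only the bound on the third derivative degenerates as \<open>\<delta>\<close> tends
  to \<open>0\<close>, and the comparison inequality is expressed by the first two alone.
\<close>

lemma C3_approximation:
  fixes g g' g'' :: "real \<Rightarrow> real"
  assumes g: "\<And>x. (g has_real_derivative g' x) (at x)" "\<And>x. (g' has_real_derivative g'' x) (at x)"
    and B: "\<And>x. \<bar>g' x\<bar> \<le> B1" "\<And>x. \<bar>g'' x\<bar> \<le> B2" and \<delta>: "\<delta> > 0"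
  obtains h h1 h2 h3 where
    "\<And>x. (h has_real_derivative h1 x) (at x)" "\<And>x. (h1 has_real_derivative h2 x) (at x)"
    "\<And>x. (h2 has_real_derivative h3 x) (at x)"
    "\<And>x. \<bar>h1 x\<bar> \<le> B1" "\<And>x. \<bar>h2 x\<bar> \<le> B2" "\<And>x. \<bar>h3 x\<bar> \<le> 2 * B2 / \<delta>"
    "\<And>x. \<bar>h x - g x\<bar> \<le> \<delta> * B1"
proof -
  have "\<exists>G. \<forall>x::real. - \<infinity> < ereal x \<longrightarrow> ereal x < \<infinity> \<longrightarrow> (G has_vector_derivative g x) (at x)"
    using g(1) by (intro einterval_antiderivative) (auto intro: DERIV_isCont)
  then obtain G where G: "\<And>x. (G has_real_derivative g x) (at x)"
    by (auto simp: has_real_derivative_iff_has_vector_derivative)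
  define avg where "avg u x = (u (x + \<delta>) - u x) / \<delta>" for u :: "real \<Rightarrow> real" and x
  have D: "(avg u has_real_derivative avg u' x) (at x)"
    if u: "\<And>x. (u has_real_derivative u' x) (at x)" for u u' x
  proof -
    have "((\<lambda>x. u (x + \<delta>)) has_real_derivative u' (x + \<delta>)) (at x)"
      using u[of "x + \<delta>"] by (simp add: DERIV_shift)
    then show ?thesis
      unfolding avg_def[abs_def] by (intro DERIV_cdivide DERIV_diff u)
  qed
  have mean: "\<exists>\<xi>. x < \<xi> \<and> \<xi> < x + \<delta> \<and> avg u x = u' \<xi>"
    if u: "\<And>x. (u has_real_derivative u' x) (at x)" for u u' x
    using MVT2[of x "x + \<delta>" u u'] u \<delta> by (auto simp: avg_def)
  show ?thesis
  proof (rule that[of "avg G" "avg g" "avg g'" "avg g''"])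
    show "(avg G has_real_derivative avg g x) (at x)" "(avg g has_real_derivative avg g' x) (at x)" for x
      by (rule D, rule G, rule D, rule g)
    show "\<bar>avg g x\<bar> \<le> B1" "\<bar>avg g' x\<bar> \<le> B2" for x
      using mean[OF g(1), of x] mean[OF g(2), of x] B by auto
  next
    show "\<bar>avg g'' x\<bar> \<le> 2 * B2 / \<delta>" for x
      using B(2)[of x] B(2)[of "x + \<delta>"] \<delta> by (simp add: avg_def abs_divide divide_right_mono)
  next
    show "\<bar>avg G x - g x\<bar> \<le> \<delta> * B1" for x
    proof -
      obtain \<xi> where \<xi>: "x < \<xi>" "\<xi> < x + \<delta>" "avg G x = g \<xi>" using mean[OF G, of x] by blast
      obtain \<zeta> where "g \<xi> - g x = (\<xi> - x) * g' \<zeta>" using MVT2[OF \<xi>(1), of g g'] g(1) by blast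
      moreover have "\<bar>(\<xi> - x) * g' \<zeta>\<bar> \<le> \<delta> * B1"
        unfolding abs_mult using \<xi> B(1)[of \<zeta>] by (intro mult_mono) auto
      ultimately show ?thesis using \<xi>(3) by simp
    qed
  qed (rule D, rule g)
qed

lemma lipschitz_on_bounded_deriv:
  fixes g :: "real \<Rightarrow> real"
  assumes "\<And>x. (g has_real_derivative g' x) (at x)" "\<And>x. \<bar>g' x\<bar> \<le> B"
  shows "B-lipschitz_on UNIV g"
proof (rule lipschitz_onI)
  show "0 \<le> B" using assms(2)[of 0] by linarith
  show "dist (g x) (g y) \<le> B * dist x y" for x y
    using field_differentiable_bound[of UNIV g g' B x y] assms
    by (simp add: dist_norm has_field_derivative_at_within)
qed

section \<open>The comparison inequality for maxima\<close>

lemma gaussian_smooth_max_comparison_C3: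
  fixes X Y :: "'w \<Rightarrow> real ^ 'n"
  assumes M: "prob_space M" and X: "gaussian_vector M X" "centered M X"
    and Y: "gaussian_vector M Y" "centered M Y" and \<beta>: "\<beta> > 0"
    and g: "\<And>x. (g has_real_derivative g1 x) (at x)" "\<And>x. (g1 has_real_derivative g2 x) (at x)"
      "\<And>x. (g2 has_real_derivative g3 x) (at x)"
    and B: "\<And>x. \<bar>g1 x\<bar> \<le> B1" "\<And>x. \<bar>g2 x\<bar> \<le> B2" "\<And>x. \<bar>g3 x\<bar> \<le> B3"
    and \<Delta>: "\<And>j k. \<bar>covariance_matrix M X $ j $ k - covariance_matrix M Y $ j $ k\<bar> \<le> \<Delta>"
  shows "\<bar>(\<integral>w. g (smooth_max \<beta> (X w)) \<partial>M) - (\<integral>w. g (smooth_max \<beta> (Y w)) \<partial>M)\<bar> \<le> (B2 / 2 + \<beta> * B1) * \<Delta>"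
proof -
  have lip: "(B1 * 1)-lipschitz_on UNIV (\<lambda>x. g (smooth_max \<beta> (x :: real ^ 'n)))"
    using lipschitz_on_compose[OF smooth_max_lipschitz[OF \<beta>]
        lipschitz_on_subset[OF lipschitz_on_bounded_deriv[OF g(1) B(1)] subset_UNIV]]
    by (simp add: o_def)
  have "\<bar>(\<integral>w. g (smooth_max \<beta> (X w)) \<partial>M) - (\<integral>w. g (smooth_max \<beta> (Y w)) \<partial>M)\<bar>
      \<le> (B2 + 2 * \<beta> * B1) / 2 * \<Delta>"
  proof (rule gaussian_comparison[OF M X Y lip _ \<Delta>])
    fix x :: "real ^ 'n"
    define a :: "real ^ 'n" where
      "a = (\<chi> j. g1 (smooth_max \<beta> x) * (exp (\<beta> * x $ j) / (\<Sum>i\<in>UNIV. exp (\<beta> * x $ i))))"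
    have a: "a \<bullet> v = g1 (smooth_max \<beta> x) * gibbs_moment \<beta> x v 1" for v
      by (simp add: a_def gibbs_moment_def inner_vec_def sum_divide_distrib sum_distrib_left mult_ac)
    show "\<exists>a H. (\<forall>v. \<bar>g (smooth_max \<beta> (x + v)) - g (smooth_max \<beta> x) - a \<bullet> v
         - (\<Sum>j\<in>UNIV. \<Sum>k\<in>UNIV. H $ j $ k * (v $ j * v $ k)) / 2\<bar>
           \<le> (B3 + 6 * \<beta> * B2 + 6 * \<beta>\<^sup>2 * B1) * norm v ^ 3)
       \<and> (\<Sum>j\<in>UNIV. \<Sum>k\<in>UNIV. \<bar>H $ j $ k\<bar>) \<le> B2 + 2 * \<beta> * B1"
      using smooth_max_taylor[OF \<beta> g B, of x] smooth_max_hessian_abs_sum_le[of \<beta> g1 B1 g2 B2 x, OF \<beta> B(1,2)]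
      unfolding a[symmetric] by blast
  qed
  then show ?thesis by (simp add: field_simps)
qed

lemma abs_le_sup_norm: "bounded (range h) \<Longrightarrow> \<bar>h x\<bar> \<le> sup_norm h"
  unfolding sup_norm_def
  by (rule cSUP_upper) (auto simp: bounded_iff bdd_above_def)

lemma abs_integral_diff_le:
  fixes u v :: "'w \<Rightarrow> real"
  assumes M: "prob_space M" and u: "integrable M u" and v: "integrable M v" and d: "\<And>w. \<bar>u w - v w\<bar> \<le> d"
  shows "\<bar>(\<integral>w. u w \<partial>M) - (\<integral>w. v w \<partial>M)\<bar> \<le> d"
proof -
  interpret prob_space M by fact
  have "\<bar>\<integral>w. u w - v w \<partial>M\<bar> \<le> (\<integral>w. d \<partial>M)"
    using u v d by (intro order_trans[OF integral_abs_bound integral_mono]) auto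
  then show ?thesis using u v by (simp add: prob_space)
qed

text \<open>
  The bound for the moving average of \<open>g\<close> carries over, since it is uniformly close to \<open>g\<close>.
\<close>

lemma gaussian_smooth_max_comparison:
  fixes X Y :: "'w \<Rightarrow> real ^ 'n"
  assumes M: "prob_space M" and X: "gaussian_vector M X" "centered M X"
    and Y: "gaussian_vector M Y" "centered M Y" and \<beta>: "\<beta> > 0"
    and g: "\<And>x. (g has_real_derivative g' x) (at x)" "\<And>x. (g' has_real_derivative g'' x) (at x)"
    and B: "\<And>x. \<bar>g' x\<bar> \<le> B1" "\<And>x. \<bar>g'' x\<bar> \<le> B2"
    and \<Delta>: "\<And>j k. \<bar>covariance_matrix M X $ j $ k - covariance_matrix M Y $ j $ k\<bar> \<le> \<Delta>"
  shows "\<bar>(\<integral>w. g (smooth_max \<beta> (X w)) \<partial>M) - (\<integral>w. g (smooth_max \<beta> (Y w)) \<partial>M)\<bar> \<le> (B2 / 2 + \<beta> * B1) * \<Delta>"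
    (is "?d \<le> ?b")
proof (rule field_le_epsilon)
  fix e :: real assume e: "e > 0"
  have B1: "0 \<le> B1" using B(1)[of 0] by linarith
  \<comment> \<open>Both expectations change by at most \<open>\<delta> B1\<close>; adding \<open>1\<close> keeps the denominator positive when \<open>B1 = 0\<close>.\<close>
  define \<delta> where "\<delta> = e / (2 * (B1 + 1))"
  have \<delta>: "\<delta> > 0" "2 * (\<delta> * B1) \<le> e" using e B1 by (simp_all add: \<delta>_def field_simps)
  obtain h h1 h2 h3 where h: "\<And>x. (h has_real_derivative h1 x) (at x)" "\<And>x. (h1 has_real_derivative h2 x) (at x)"
    "\<And>x. (h2 has_real_derivative h3 x) (at x)"
    "\<And>x. \<bar>h1 x\<bar> \<le> B1" "\<And>x. \<bar>h2 x\<bar> \<le> B2" "\<And>x. \<bar>h3 x\<bar> \<le> 2 * B2 / \<delta>"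
    "\<And>x. \<bar>h x - g x\<bar> \<le> \<delta> * B1"
    using C3_approximation[OF g B \<delta>(1)] by blast
  note int = gaussian_vector_integrable(1)[OF M]
  have close: "\<bar>(\<integral>w. h (smooth_max \<beta> (Z w)) \<partial>M) - (\<integral>w. g (smooth_max \<beta> (Z w)) \<partial>M)\<bar> \<le> \<delta> * B1"
    if Z: "gaussian_vector M Z" for Z :: "'w \<Rightarrow> real ^ 'n"
  proof (rule abs_integral_diff_le[OF M _ _ h(7)])
    note F = integrable_lipschitz[OF M int[OF Z] smooth_max_lipschitz[OF \<beta>]]
    show "integrable M (\<lambda>w. h (smooth_max \<beta> (Z w)))" "integrable M (\<lambda>w. g (smooth_max \<beta> (Z w)))"
      using integrable_lipschitz[OF M F lipschitz_on_bounded_deriv[OF h(1,4)]]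
        integrable_lipschitz[OF M F lipschitz_on_bounded_deriv[OF g(1) B(1)]] by auto
  qed
  show "?d \<le> ?b + e"
    using gaussian_smooth_max_comparison_C3[OF M X Y \<beta> h(1-6) \<Delta>] close[OF X(1)] close[OF Y(1)] \<delta>(2)
    by linarith
qed

theorem theorem1:
  fixes M :: "'w measure" and X Y :: "'w \<Rightarrow> real ^ 'n"
    and g :: "real \<Rightarrow> real" and \<beta> \<Delta> :: real
  assumes "prob_space M"
    and "gaussian_vector M X" and "centered M X"
    and "gaussian_vector M Y" and "centered M Y"
    and "\<Delta> = max_entry_diff (covariance_matrix M X) (covariance_matrix M Y)"
    and "C2 g"
    and "bounded (range (deriv g))" and "bounded (range (deriv (deriv g)))"
    and "\<beta> > 0"
  shows "integrable M (\<lambda>w. g (smooth_max \<beta> (X w)))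
       \<and> integrable M (\<lambda>w. g (smooth_max \<beta> (Y w)))
       \<and> \<bar>\<integral>w. g (smooth_max \<beta> (X w)) - g (smooth_max \<beta> (Y w)) \<partial>M\<bar>
           \<le> (sup_norm (deriv (deriv g)) / 2 + \<beta> * sup_norm (deriv g)) * \<Delta>
       \<and> integrable M (\<lambda>w. g (max_component (X w)))
       \<and> integrable M (\<lambda>w. g (max_component (Y w)))
       \<and> \<bar>\<integral>w. g (max_component (X w)) - g (max_component (Y w)) \<partial>M\<bar>
           \<le> (sup_norm (deriv (deriv g)) / 2 + \<beta> * sup_norm (deriv g)) * \<Delta>
             + 2 * inverse \<beta> * sup_norm (deriv g) * ln (real CARD('n))"
proof -
  let ?B1 = "sup_norm (deriv g)" and ?B2 = "sup_norm (deriv (deriv g))"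
  have g: "(g has_real_derivative deriv g x) (at x)" "(deriv g has_real_derivative deriv (deriv g) x) (at x)" for x
    using \<open>C2 g\<close> unfolding C2_def
    by (auto intro!: DERIV_deriv_iff_real_differentiable[THEN iffD2])
  have B: "\<bar>deriv g x\<bar> \<le> ?B1" "\<bar>deriv (deriv g) x\<bar> \<le> ?B2" for x
    using assms(8,9) by (auto intro: abs_le_sup_norm)
  have g_lip: "?B1-lipschitz_on UNIV g" by (rule lipschitz_on_bounded_deriv[OF g(1) B(1)])
  have \<Delta>: "\<bar>covariance_matrix M X $ j $ k - covariance_matrix M Y $ j $ k\<bar> \<le> \<Delta>" for j k
    unfolding assms(6) max_entry_diff_def
  proof (rule Max_ge)
    show "finite {\<bar>covariance_matrix M X $ j $ k - covariance_matrix M Y $ j $ k\<bar> |j k. True}"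
      by (rule finite_subset[of _ "(\<lambda>(j, k). \<bar>covariance_matrix M X $ j $ k - covariance_matrix M Y $ j $ k\<bar>) ` UNIV"]) auto
  qed auto
  note int = integrable_lipschitz[OF assms(1) gaussian_vector_integrable(1)[OF assms(1)]]
  have F_int: "integrable M (\<lambda>w. g (smooth_max \<beta> (Z w)))"
    and max_int: "integrable M (\<lambda>w. g (max_component (Z w)))"
    if "gaussian_vector M Z" for Z :: "'w \<Rightarrow> real ^ 'n"
    using integrable_lipschitz[OF assms(1) int[OF that smooth_max_lipschitz[OF assms(10)]] g_lip]
      integrable_lipschitz[OF assms(1) int[OF that max_component_lipschitz] g_lip] by auto
  have smooth: "\<bar>(\<integral>w. g (smooth_max \<beta> (X w)) \<partial>M) - (\<integral>w. g (smooth_max \<beta> (Y w)) \<partial>M)\<bar> \<le> (?B2 / 2 + \<beta> * ?B1) * \<Delta>"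
    by (rule gaussian_smooth_max_comparison[OF assms(1-5,10) g B \<Delta>])
  have max_smooth: "\<bar>(\<integral>w. g (max_component (Z w)) \<partial>M) - (\<integral>w. g (smooth_max \<beta> (Z w)) \<partial>M)\<bar>
      \<le> ?B1 * (inverse \<beta> * ln (real CARD('n)))"
    if Z: "gaussian_vector M Z" for Z :: "'w \<Rightarrow> real ^ 'n"
  proof (rule abs_integral_diff_le[OF assms(1) max_int[OF Z] F_int[OF Z]])
    fix w
    have "\<bar>g (max_component (Z w)) - g (smooth_max \<beta> (Z w))\<bar> \<le> ?B1 * \<bar>max_component (Z w) - smooth_max \<beta> (Z w)\<bar>"
      using lipschitz_on_growth(1)[OF g_lip] by (simp only: real_norm_def)
    also have "\<dots> \<le> ?B1 * (inverse \<beta> * ln (real CARD('n)))"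
      by (rule mult_left_mono[OF max_component_smooth_max[OF assms(10)] lipschitz_on_nonneg[OF g_lip]])
    finally show "\<bar>g (max_component (Z w)) - g (smooth_max \<beta> (Z w))\<bar> \<le> ?B1 * (inverse \<beta> * ln (real CARD('n)))" .
  qed
  have "\<bar>(\<integral>w. g (max_component (X w)) \<partial>M) - (\<integral>w. g (max_component (Y w)) \<partial>M)\<bar>
      \<le> (?B2 / 2 + \<beta> * ?B1) * \<Delta> + 2 * inverse \<beta> * ?B1 * ln (real CARD('n))"
    using smooth max_smooth[OF assms(2)] max_smooth[OF assms(4)] by (simp add: mult_ac)
  then show ?thesis
    using smooth F_int[OF assms(2)] F_int[OF assms(4)] max_int[OF assms(2)] max_int[OF assms(4)] by simp
qed

end
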